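(* The operator $\Xi$ satisfies $\Phi^+\Xi=\Xi\Phi$ and $\sigma_i^+\Xi=\Xi s_i$ for all $1\le i\le n-1$.
   Context: Fix $n\ge1$; $r$ is an indeterminate, $\alpha=1/r$, $\mathbb{F}=\mathbb{Q}(r)$, polynomials lie in $\mathbb{F}[x_1,\dots,x_n]$. Compositions are $\eta\in\mathbb{N}^n$, $|\eta|=\sum\eta_i$, $x^\eta=\prod x_i^{\eta_i}$; partitions are weakly decreasing compositions; $\delta=(n-1,\dots,0)$; permutations act on vectors by $(wv)_{w(i)}=v_i$; $w_\gamma$ is the minimal-length permutation with $w_\gamma^{-1}(\gamma)$ a partition, $\overline\gamma=\gamma+w_\gamma(r\delta)$. $E_\eta^{r\delta}$ is the unique polynomial of degree $|\eta|$ vanishing at all $\overline\gamma$ with $\gamma\ne\eta$, $|\gamma|\le|\eta|$, with coefficient $1$ on $x^\eta$; $E_\eta^{(\alpha)}$ its top homogeneous component. With $a_\eta(i,j)=\eta_i-j$, $l_\eta(i,j)=\#\{k>i:j\le\eta_k\le\eta_i\}+\#\{k<i:j\le\eta_k+1\le\eta_i\}$, $d_\eta(\alpha)=\prod_{1\le j\le\eta_i}(\alpha(a_\eta(i,j)+1)+l_\eta(i,j)+1)$, set $F_\eta^{(\alpha)}=d_\eta E_\eta^{(\alpha)}$, $F_\eta^{r\delta}(x)=(-1)^{|\eta|}d_\eta E_\eta^{r\delta}(-x)$; $\Xi$ is the unique $\mathbb{F}$-linear operator with $\Xi(F_\eta^{(\alpha)})=F_\eta^{r\delta}$ for all $\eta$.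 Operators: $s_i$ swaps $x_i,x_{i+1}$; $\partial_if=(s_if-f)/(x_i-x_{i+1})$; $\sigma_i^+=s_i+r\partial_i$; $\Phi f(x)=x_nf(x_n,x_1,\dots,x_{n-1})$; $\Phi^+f(x)=x_nf(x_n+1,x_1,\dots,x_{n-1})$. *)

theory Defs
  imports "HOL-Library.Poly_Mapping" "HOL-Library.FuncSet"
    "HOL-Combinatorics.Permutations" "HOL-Computational_Algebra.Computational_Algebra"
begin

section \<open>The ground field $\mathbb{Q}(r)$\<close>

type_synonym ratfun = "rat poly fract"

definition r_ind :: ratfun where
  "r_ind = Fract [:0, 1:] 1"

definition alpha :: ratfun where
  "alpha = 1 / r_ind"


section \<open>Polynomials in $x_1,\dots,x_n$\<close>

text \<open>
  A finitely supported exponent vector \<open>m\<close> stands for the monomial \<open>x\<^sup>m\<close>, and a polynomial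
  is a finitely supported function from exponent vectors to coefficients, with convolution
  as product. Indices of variables are natural numbers; \<open>polys n\<close> cuts out the
  polynomials in which only the variables with indices $1,\dots,n$ occur.
\<close>

type_synonym expo = "nat \<Rightarrow>\<^sub>0 nat"
type_synonym mpoly = "expo \<Rightarrow>\<^sub>0 ratfun"

definition compositions :: "nat \<Rightarrow> expo set" where
  "compositions n = {\<eta>. Poly_Mapping.keys \<eta> \<subseteq> {1..n}}"

definition weight :: "expo \<Rightarrow> nat" where
  "weight \<eta> = (\<Sum>i\<in>Poly_Mapping.keys \<eta>. Poly_Mapping.lookup \<eta> i)"

definition polys :: "nat \<Rightarrow> mpoly set" where
  "polys n = {f. Poly_Mapping.keys f \<subseteq> compositions n}"

definition Const :: "ratfun \<Rightarrow> mpoly" where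
  "Const c = Poly_Mapping.single 0 c"

definition Var :: "nat \<Rightarrow> mpoly" where
  "Var i = Poly_Mapping.single (Poly_Mapping.single i 1) 1"

definition total_degree :: "mpoly \<Rightarrow> nat" where
  "total_degree f = Max (insert 0 (weight ` Poly_Mapping.keys f))"

definition hom_component :: "nat \<Rightarrow> mpoly \<Rightarrow> mpoly" where
  "hom_component d f =
     (\<Sum>m | m \<in> Poly_Mapping.keys f \<and> weight m = d.
        Poly_Mapping.single m (Poly_Mapping.lookup f m))"

definition top_component :: "mpoly \<Rightarrow> mpoly" where
  "top_component f = hom_component (total_degree f) f"

definition eval_at :: "(nat \<Rightarrow> ratfun) \<Rightarrow> mpoly \<Rightarrow> ratfun" where
  "eval_at v f =
     (\<Sum>m\<in>Poly_Mapping.keys f.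
        Poly_Mapping.lookup f m * (\<Prod>i\<in>Poly_Mapping.keys m. v i ^ Poly_Mapping.lookup m i))"

text \<open>\<open>subst p f\<close> is $f(p_1,p_2,\dots)$, i.e. each variable $x_i$ is replaced by the polynomial \<open>p i\<close>.\<close>

definition subst :: "(nat \<Rightarrow> mpoly) \<Rightarrow> mpoly \<Rightarrow> mpoly" where
  "subst p f =
     (\<Sum>m\<in>Poly_Mapping.keys f.
        Const (Poly_Mapping.lookup f m) *
        (\<Prod>i\<in>Poly_Mapping.keys m. p i ^ Poly_Mapping.lookup m i))"


section \<open>Permutations and the points $\overline\gamma$\<close>

text \<open>Vectors are functions on indices, of which only the values on $1,\dots,n$ matter.\<close>

definition perm_act :: "(nat \<Rightarrow> nat) \<Rightarrow> (nat \<Rightarrow> 'a) \<Rightarrow> nat \<Rightarrow> 'a" where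
  "perm_act w v = (\<lambda>j. v (inv w j))"

definition perm_length :: "nat \<Rightarrow> (nat \<Rightarrow> nat) \<Rightarrow> nat" where
  "perm_length n w = card {(i, j). 1 \<le> i \<and> i < j \<and> j \<le> n \<and> w j < w i}"

definition is_partition :: "nat \<Rightarrow> (nat \<Rightarrow> nat) \<Rightarrow> bool" where
  "is_partition n v \<longleftrightarrow> (\<forall>i j. 1 \<le> i \<and> i \<le> j \<and> j \<le> n \<longrightarrow> v j \<le> v i)"

text \<open>The minimiser is unique: it is the shortest element of a coset of the stabiliser of a partition.\<close>

definition w_min :: "nat \<Rightarrow> expo \<Rightarrow> nat \<Rightarrow> nat" where
  "w_min n \<gamma> = arg_min (perm_length n)
     (\<lambda>w. w permutes {1..n} \<and> is_partition n (perm_act (inv w) (Poly_Mapping.lookup \<gamma>)))"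

definition delta :: "nat \<Rightarrow> nat \<Rightarrow> nat" where
  "delta n i = n - i"

definition bar :: "nat \<Rightarrow> expo \<Rightarrow> nat \<Rightarrow> ratfun" where
  "bar n \<gamma> i =
     of_nat (Poly_Mapping.lookup \<gamma> i)
     + perm_act (w_min n \<gamma>) (\<lambda>k. r_ind * of_nat (delta n k)) i"


section \<open>The polynomials $E$ and $F$\<close>

text \<open>\<open>E_interp n \<eta>\<close> is $E_\eta^{r\delta}$ and \<open>E_top n \<eta>\<close> is $E_\eta^{(\alpha)}$.\<close>

definition E_interp :: "nat \<Rightarrow> expo \<Rightarrow> mpoly" where
  "E_interp n \<eta> = (THE f. f \<in> polys n \<and> total_degree f = weight \<eta> \<and>
     (\<forall>\<gamma>\<in>compositions n. \<gamma> \<noteq> \<eta> \<and> weight \<gamma> \<le> weight \<eta> \<longrightarrow> eval_at (bar n \<gamma>) f = 0) \<and>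
     Poly_Mapping.lookup f \<eta> = 1)"

definition E_top :: "nat \<Rightarrow> expo \<Rightarrow> mpoly" where
  "E_top n \<eta> = top_component (E_interp n \<eta>)"

definition arm :: "expo \<Rightarrow> nat \<Rightarrow> nat \<Rightarrow> nat" where
  "arm \<eta> i j = Poly_Mapping.lookup \<eta> i - j"

definition leg :: "nat \<Rightarrow> expo \<Rightarrow> nat \<Rightarrow> nat \<Rightarrow> nat" where
  "leg n \<eta> i j =
     card {k\<in>{1..n}. i < k \<and> j \<le> Poly_Mapping.lookup \<eta> k \<and>
             Poly_Mapping.lookup \<eta> k \<le> Poly_Mapping.lookup \<eta> i}
   + card {k\<in>{1..n}. k < i \<and> j \<le> Poly_Mapping.lookup \<eta> k + 1 \<and>
             Poly_Mapping.lookup \<eta> k + 1 \<le> Poly_Mapping.lookup \<eta> i}"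

definition d_coeff :: "nat \<Rightarrow> expo \<Rightarrow> ratfun \<Rightarrow> ratfun" where
  "d_coeff n \<eta> a =
     (\<Prod>i\<in>{1..n}. \<Prod>j\<in>{1..Poly_Mapping.lookup \<eta> i}.
        a * (of_nat (arm \<eta> i j) + 1) + of_nat (leg n \<eta> i j) + 1)"

text \<open>\<open>F_top n \<eta>\<close> is $F_\eta^{(\alpha)}$ and \<open>F_interp n \<eta>\<close> is $F_\eta^{r\delta}$.\<close>

definition F_top :: "nat \<Rightarrow> expo \<Rightarrow> mpoly" where
  "F_top n \<eta> = Const (d_coeff n \<eta> alpha) * E_top n \<eta>"

definition F_interp :: "nat \<Rightarrow> expo \<Rightarrow> mpoly" where
  "F_interp n \<eta> =
     Const ((-1) ^ weight \<eta> * d_coeff n \<eta> alpha) * subst (\<lambda>i. - Var i) (E_interp n \<eta>)"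


section \<open>The operators\<close>

text \<open>
  Operators act on \<open>polys n\<close>. For \<open>Xi\<close>, the extensional function space pins down the
  irrelevant values outside \<open>polys n\<close>, so that uniqueness is meaningful.
\<close>

definition linear_op :: "nat \<Rightarrow> (mpoly \<Rightarrow> mpoly) \<Rightarrow> bool" where
  "linear_op n T \<longleftrightarrow>
     (\<forall>f\<in>polys n. \<forall>g\<in>polys n. T (f + g) = T f + T g) \<and>
     (\<forall>c. \<forall>f\<in>polys n. T (Const c * f) = Const c * T f)"

definition Xi :: "nat \<Rightarrow> mpoly \<Rightarrow> mpoly" where
  "Xi n = (THE T. T \<in> polys n \<rightarrow>\<^sub>E polys n \<and> linear_op n T \<and>
     (\<forall>\<eta>\<in>compositions n. T (F_top n \<eta>) = F_interp n \<eta>))"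

definition s_op :: "nat \<Rightarrow> mpoly \<Rightarrow> mpoly" where
  "s_op i f = subst (\<lambda>k. Var (transpose i (Suc i) k)) f"

text \<open>The polynomial ring is a domain, so the quotient below is unique (and it always exists).\<close>

definition div_diff :: "nat \<Rightarrow> mpoly \<Rightarrow> mpoly" where
  "div_diff i f = (THE g. g * (Var i - Var (Suc i)) = s_op i f - f)"

definition sigma_plus :: "nat \<Rightarrow> mpoly \<Rightarrow> mpoly" where
  "sigma_plus i f = s_op i f + Const r_ind * div_diff i f"

definition Phi :: "nat \<Rightarrow> mpoly \<Rightarrow> mpoly" where
  "Phi n f = Var n * subst (\<lambda>k. if k = 1 then Var n else Var (k - 1)) f"

definition Phi_plus :: "nat \<Rightarrow> mpoly \<Rightarrow> mpoly" where
  "Phi_plus n f = Var n * subst (\<lambda>k. if k = 1 then Var n + 1 else Var (k - 1)) f"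

end

theory Submission
  imports Defs
begin

text \<open>
  A homogeneous polynomial $g$ of degree $d$ has a unique lift, a polynomial $f$ with leading part
  $g$ that vanishes at all $\overline\gamma$ with $|\gamma| < d$. The polynomial $E_\eta^{r\delta}$
  is the lift of $E_\eta^{(\alpha)}$, and the latter form a basis, so $\Xi$ maps $g$ to
  $(-1)^d f(-x)$. Hence it is enough that the operators conjugated by $x \mapsto -x$,
  up to sign $x_n f(x_n - 1, x_1, \dots, x_{n-1})$ and $s_i f - r \partial_i f$, have leading parts
  $\Phi$ and $s_i$ and preserve the vanishing conditions, which can be read off the points
  $\overline\gamma$. Neither recursions for the $E_\eta$ nor their triangularity are needed:
  at $r = 0$ the points $\overline\gamma$ become the lattice points $\gamma$, where interpolation is
  uniquely solvable by finite differences, and this carries over to $\mathbb{Q}(r)$.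
\<close>

section \<open>Linear extensions and substitution homomorphisms\<close>

text \<open>Preservation of vanishing is one mechanism used twice: at a point
  \<open>bar n \<gamma>\<close> either a coefficient of the operator is zero, or the operator reads
  \<open>f\<close> at another such point. For the rotation, \<open>\<gamma>_n = 0\<close> gives
  \<open>x_n = 0\<close>; otherwise the new point belongs to a composition of weight one less, so
  the condition moves from degree \<open>d\<close> to \<open>d + 1\<close>. For
  \<open>s_i - r \<partial>_i\<close>, a polynomial vanishing at the point gets there the value of
  \<open>s_i f\<close> times \<open>1 - r / (x_i - x_(i+1))\<close>. This is zero if
  \<open>\<gamma>_i = \<gamma>_(i+1)\<close>, because the two coordinates then differ by exactly r;
  otherwise the swapped point belongs to a composition of the same weight. Both arguments rest on
  knowing the coordinate as \<open>\<gamma>_i\<close> plus r times the number of positions sorted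
  after i, so the minimal permutation must be identified as the one that sorts stably.

  The sign \<open>(-1)^d\<close> in \<Xi> is what makes the rotation fit: it raises the degree by
  one, and its factor \<open>x_n\<close> changes sign under \<open>x -> -x\<close>.\<close>

abbreviation "supp \<equiv> Poly_Mapping.keys"
abbreviation "coef \<equiv> Poly_Mapping.lookup"
abbreviation "single \<equiv> Poly_Mapping.single"

abbreviation X :: "expo \<Rightarrow> mpoly" where "X m \<equiv> single m 1"

definition mon :: "(nat \<Rightarrow> 'b::comm_monoid_mult) \<Rightarrow> expo \<Rightarrow> 'b" where
  "mon v m = (\<Prod>i\<in>supp m. v i ^ coef m i)"

text \<open>With \<open>h = mon v\<close> this covers both \<open>eval_at\<close> (\<open>c\<close>
  the identity) and \<open>subst\<close> (\<open>c = Const\<close>). The map \<open>h\<close> is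
  arbitrary because \<open>lift_op\<close> extends an assignment on monomials that need not be
  multiplicative.\<close>

definition lin_ext :: "(ratfun \<Rightarrow> 'b::comm_ring_1) \<Rightarrow> (expo \<Rightarrow> 'b) \<Rightarrow> mpoly \<Rightarrow> 'b" where
  "lin_ext c h f = (\<Sum>m\<in>supp f. c (coef f m) * h m)"

lemma mon_superset:
  assumes "finite S" "supp m \<subseteq> S"
  shows "mon v m = (\<Prod>i\<in>S. v i ^ coef m i)"
  unfolding mon_def using assms
  by (intro prod.mono_neutral_left) (auto simp: in_keys_iff)

lemma mon_add: "mon v (m + m') = mon v m * mon v m'"
proof -
  let ?S = "supp m \<union> supp m'"
  have "mon v (m + m') = (\<Prod>i\<in>?S. v i ^ coef (m + m') i)"
    by (rule mon_superset) (auto dest: Poly_Mapping.keys_add[THEN subsetD])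
  also have "\<dots> = (\<Prod>i\<in>?S. v i ^ coef m i) * (\<Prod>i\<in>?S. v i ^ coef m' i)"
    by (simp add: lookup_add power_add prod.distrib)
  finally show ?thesis
    by (simp add: mon_superset[of ?S m] mon_superset[of ?S m'])
qed

lemma mon_0 [simp]: "mon v 0 = 1"
  by (simp add: mon_def)

lemma mon_single [simp]: "mon v (single i 1) = v i"
  by (simp add: mon_def)

lemma Const_0 [simp]: "Const 0 = 0" and Const_1 [simp]: "Const 1 = 1"
  by (simp_all add: Const_def)

lemma Const_add: "Const (a + b) = Const a + Const b"
  by (simp add: Const_def single_add)

lemma Const_uminus: "Const (- a) = - Const a"
  by (simp add: Const_def single_uminus)

lemma Const_mult: "Const (a * b) = Const a * Const b"
  by (simp add: Const_def mult_single)

lemma Const_single: "Const a * single m b = single m (a * b)"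
  by (simp add: Const_def mult_single)

lemma coef_Const_mult [simp]: "coef (Const a * f) m = a * coef f m"
proof -
  have "Const a * f = Poly_Mapping.map ((*) a) f"
    by (simp add: Const_def mult_map_scale_conv_mult)
  then show ?thesis
    by (simp add: Poly_Mapping.map.rep_eq when_def)
qed

lemma supp_Const_mult: "supp (Const a * f) \<subseteq> supp f"
  by (auto simp: in_keys_iff)

lemma mpoly_sum: "f = (\<Sum>m\<in>supp f. single m (coef f m))"
  by (rule poly_mapping_eqI)
     (auto simp: lookup_sum lookup_single when_def in_keys_iff)

lemma mpoly_sum_X: "f = (\<Sum>m\<in>supp f. Const (coef f m) * X m)"
  using mpoly_sum[of f] by (simp add: Const_single)

lemma mpoly_induct [case_names zero single add]:
  fixes f :: mpoly
  assumes "P 0" "\<And>m c. P (single m c)" "\<And>f g. P f \<Longrightarrow> P g \<Longrightarrow> P (f + g)"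
  shows "P f"
proof -
  have "finite S \<Longrightarrow> P (\<Sum>m\<in>S. single m (coef f m))" for S
    by (induction S rule: finite_induct) (auto intro: assms)
  then show ?thesis
    by (subst mpoly_sum) auto
qed

locale coeff_hom =
  fixes c :: "ratfun \<Rightarrow> 'b::comm_ring_1"
  assumes hom_0: "c 0 = 0" and hom_1: "c 1 = 1"
    and hom_add: "c (a + b) = c a + c b" and hom_mult: "c (a * b) = c a * c b"
begin

lemma lin_ext_superset:
  assumes "finite S" "supp f \<subseteq> S"
  shows "lin_ext c h f = (\<Sum>m\<in>S. c (coef f m) * h m)"
  unfolding lin_ext_def using assms
  by (intro sum.mono_neutral_left) (auto simp: in_keys_iff hom_0)

lemma lin_ext_0: "lin_ext c h 0 = 0"
  by (simp add: lin_ext_def)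

lemma lin_ext_add: "lin_ext c h (f + g) = lin_ext c h f + lin_ext c h g"
proof -
  let ?S = "supp f \<union> supp g"
  have "lin_ext c h (f + g) = (\<Sum>m\<in>?S. c (coef (f + g) m) * h m)"
    by (rule lin_ext_superset) (auto dest: Poly_Mapping.keys_add[THEN subsetD])
  also have "\<dots> = (\<Sum>m\<in>?S. c (coef f m) * h m) + (\<Sum>m\<in>?S. c (coef g m) * h m)"
    by (simp add: lookup_add hom_add distrib_right sum.distrib)
  finally show ?thesis
    by (simp add: lin_ext_superset[of ?S f] lin_ext_superset[of ?S g])
qed

lemma lin_ext_single: "lin_ext c h (single m a) = c a * h m"
  by (simp add: lin_ext_def hom_0)

lemma lin_ext_Const_mult: "lin_ext c h (Const a * f) = c a * lin_ext c h f"
  unfolding lin_ext_superset[OF finite_keys supp_Const_mult]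
  by (simp add: lin_ext_def hom_mult sum_distrib_left mult.assoc)

lemma lin_ext_uminus: "lin_ext c h (- f) = - lin_ext c h f"
  using lin_ext_add[of h f "- f"] by (simp add: lin_ext_0 add_eq_0_iff)

lemma lin_ext_diff: "lin_ext c h (f - g) = lin_ext c h f - lin_ext c h g"
  using lin_ext_add[of h f "- g"] by (simp add: lin_ext_uminus)

lemma lin_ext_sum: "lin_ext c h (\<Sum>i\<in>S. f i) = (\<Sum>i\<in>S. lin_ext c h (f i))"
  by (induction S rule: infinite_finite_induct) (auto simp: lin_ext_add lin_ext_0)

lemma lin_ext_mult:
  assumes h: "\<And>m m'. h (m + m') = h m * h m'"
  shows "lin_ext c h (f * g) = lin_ext c h f * lin_ext c h g"
proof (induction f rule: mpoly_induct)
  case (single m a)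
  show ?case
  proof (induction g rule: mpoly_induct)
    case (single m' b)
    show ?case
      by (simp add: mult_single lin_ext_single h hom_mult mult_ac)
  qed (auto simp: lin_ext_0 lin_ext_add algebra_simps)
qed (auto simp: lin_ext_0 lin_ext_add algebra_simps)

end

interpretation Const_hom: coeff_hom Const
  by standard (simp_all add: Const_add Const_mult)

interpretation id_hom: coeff_hom "\<lambda>x. x"
  by standard simp_all

lemma eval_at_lin: "eval_at v = lin_ext (\<lambda>x. x) (mon v)"
  by (simp add: fun_eq_iff eval_at_def lin_ext_def mon_def)

lemma subst_lin: "subst p = lin_ext Const (mon p)"
  by (simp add: fun_eq_iff subst_def lin_ext_def mon_def)

lemmas eval_at_add = id_hom.lin_ext_add[of "mon v" for v, folded eval_at_lin]
lemmas eval_at_diff = id_hom.lin_ext_diff[of "mon v" for v, folded eval_at_lin]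
lemmas eval_at_0 = id_hom.lin_ext_0[of "mon v" for v, folded eval_at_lin]
lemmas eval_at_sum = id_hom.lin_ext_sum[of "mon v" for v, folded eval_at_lin]
lemmas eval_at_Const_mult = id_hom.lin_ext_Const_mult[of "mon v" for v, folded eval_at_lin]
lemmas eval_at_single = id_hom.lin_ext_single[of "mon v" for v, folded eval_at_lin]
lemmas eval_at_mult = id_hom.lin_ext_mult[of "mon v" for v, OF mon_add, folded eval_at_lin]

lemmas subst_add = Const_hom.lin_ext_add[of "mon p" for p, folded subst_lin]
lemmas subst_diff = Const_hom.lin_ext_diff[of "mon p" for p, folded subst_lin]
lemmas subst_uminus = Const_hom.lin_ext_uminus[of "mon p" for p, folded subst_lin]
lemmas subst_0 = Const_hom.lin_ext_0[of "mon p" for p, folded subst_lin]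
lemmas subst_sum = Const_hom.lin_ext_sum[of "mon p" for p, folded subst_lin]
lemmas subst_Const_mult = Const_hom.lin_ext_Const_mult[of "mon p" for p, folded subst_lin]
lemmas subst_single = Const_hom.lin_ext_single[of "mon p" for p, folded subst_lin]
lemmas subst_mult = Const_hom.lin_ext_mult[of "mon p" for p, OF mon_add, folded subst_lin]

lemma eval_at_Const [simp]: "eval_at v (Const a) = a"
  unfolding Const_def by (simp only: eval_at_single mon_0 mult_1_right)

lemma eval_at_Var [simp]: "eval_at v (Var i) = v i"
  unfolding Var_def by (simp only: eval_at_single mon_single mult_1_left)

lemma eval_at_1 [simp]: "eval_at v 1 = 1"
  using eval_at_Const[of v 1] by simp

lemma subst_Const [simp]: "subst p (Const a) = Const a"
  unfolding Const_def by (simp only: subst_single mon_0) (simp add: Const_def)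

lemma subst_1 [simp]: "subst p 1 = 1"
  using subst_Const[of p 1] by simp

lemma subst_Var [simp]: "subst p (Var i) = p i"
  unfolding Var_def by (simp only: subst_single mon_single) simp

text \<open>Since \<open>mon\<close> turns sums of exponents into products, this reduces identities
  about it to single variables.\<close>

lemma expo_induct [case_names zero step]:
  fixes m :: expo
  assumes "P 0" "\<And>m i. P m \<Longrightarrow> P (m + single i 1)"
  shows "P m"
proof (induction "\<Sum>i\<in>supp m. coef m i" arbitrary: m)
  case 0
  then have "m = 0"
    by (intro poly_mapping_eqI) (auto simp: in_keys_iff)
  then show ?case using assms(1) by simp
next
  case (Suc k)
  then obtain i where i: "i \<in> supp m"
    by fastforce
  let ?m = "m - single i 1"
  have m: "m = ?m + single i 1"
    using i by (intro poly_mapping_eqI) (auto simp: lookup_add lookup_minus lookup_single in_keys_iff when_def)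
  have "(\<Sum>j\<in>supp m. coef m j) = (\<Sum>j\<in>supp m. coef ?m j + (if j = i then 1 else 0))"
    by (intro sum.cong refl) (use i in \<open>auto simp: lookup_minus lookup_single in_keys_iff when_def\<close>)
  also have "\<dots> = (\<Sum>j\<in>supp m. coef ?m j) + 1"
    using i by (simp add: sum.distrib)
  also have "(\<Sum>j\<in>supp m. coef ?m j) = (\<Sum>j\<in>supp ?m. coef ?m j)"
    by (rule sum.mono_neutral_right) (auto simp: in_keys_iff lookup_minus)
  finally have "k = (\<Sum>j\<in>supp ?m. coef ?m j)"
    using Suc.hyps(2) by simp
  then have "P ?m" by (rule Suc.hyps(1))
  then show ?case using assms(2)[of ?m i] m by simp
qed

lemma X_add: "X (m + m') = X m * X m'"
  by (simp add: mult_single)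

lemma X_single: "X (single i 1) = Var i"
  by (simp add: Var_def)

lemma eval_at_subst: "eval_at v (subst p f) = eval_at (\<lambda>i. eval_at v (p i)) f"
proof (induction f rule: mpoly_induct)
  case (single m a)
  have "eval_at v (mon p m) = mon (\<lambda>i. eval_at v (p i)) m"
    by (induction m rule: expo_induct) (simp_all only: mon_0 mon_add mon_single eval_at_mult eval_at_1)
  then show ?case
    by (simp add: subst_single eval_at_single eval_at_mult)
qed (auto simp: subst_0 eval_at_0 subst_add eval_at_add)

lemma subst_subst: "subst q (subst p f) = subst (\<lambda>i. subst q (p i)) f"
proof (induction f rule: mpoly_induct)
  case (single m a)
  have "subst q (mon p m) = mon (\<lambda>i. subst q (p i)) m"
    by (induction m rule: expo_induct) (simp_all only: mon_0 mon_add mon_single subst_mult subst_1)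
  then show ?case
    by (simp add: subst_single subst_mult)
qed (auto simp: subst_0 subst_add)

lemma mon_cong:
  assumes "\<And>i. i \<in> supp m \<Longrightarrow> v i = v' i"
  shows "mon v m = mon v' m"
  unfolding mon_def using assms by (intro prod.cong) auto

lemma eval_at_cong:
  assumes "f \<in> polys n" "\<And>i. i \<in> {1..n} \<Longrightarrow> v i = v' i"
  shows "eval_at v f = eval_at v' f"
  unfolding eval_at_lin lin_ext_def
proof (intro sum.cong arg_cong2[where f = "(*)"] refl mon_cong)
  fix m i assume "m \<in> supp f" "i \<in> supp m"
  then have "i \<in> {1..n}"
    using assms(1) unfolding polys_def compositions_def by blast
  then show "v i = v' i" by (rule assms(2))
qed

section \<open>Specialization at $r = 0$\<close>

text \<open>The k-th forward difference of \<open>f\<close> at 0.\<close>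

definition alt_binomial_sum :: "nat \<Rightarrow> (nat \<Rightarrow> rat) \<Rightarrow> rat" where
  "alt_binomial_sum k f = (\<Sum>g\<le>k. (-1) ^ (k - g) * of_nat (k choose g) * f g)"

text \<open>The absorption identity \<open>(g+1) * binom(k+1, g+1) = (k+1) * binom(k, g)\<close>;
  the term for 0 drops out because of the factor \<open>g\<close>. For powers this lowers the
  exponent and the order of the difference together.\<close>

lemma alt_binomial_sum_Suc:
  "alt_binomial_sum (Suc k) (\<lambda>g. of_nat g * f g) = of_nat (Suc k) * alt_binomial_sum k (\<lambda>g. f (Suc g))"
proof -
  have binom: "of_nat (Suc k choose Suc g) * of_nat (Suc g) = (of_nat (Suc k) * of_nat (k choose g) :: rat)" for g
    by (metis Suc_times_binomial_eq of_nat_mult)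
  have "alt_binomial_sum (Suc k) (\<lambda>g. of_nat g * f g) =
      (\<Sum>g\<le>k. (-1) ^ (k - g) * (of_nat (Suc k choose Suc g) * of_nat (Suc g)) * f (Suc g))"
    unfolding alt_binomial_sum_def by (subst sum.atMost_Suc_shift) (simp add: mult_ac)
  also have "\<dots> = (\<Sum>g\<le>k. (-1) ^ (k - g) * (of_nat (Suc k) * of_nat (k choose g)) * f (Suc g))"
    by (simp only: binom)
  finally show ?thesis
    by (simp add: alt_binomial_sum_def sum_distrib_left mult_ac)
qed

lemma alt_binomial_sum_power:
  "j \<le> k \<Longrightarrow> alt_binomial_sum k (\<lambda>g. of_nat g ^ j) = (if j = k then fact k else 0)"
proof (induction k arbitrary: j)
  case 0
  then show ?case by (simp add: alt_binomial_sum_def)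
next
  case (Suc k)
  show ?case
  proof (cases j)
    case 0
    \<comment> \<open>The zeroth power is the constant 1, and its difference is the expansion of
      \<open>(1 - 1) ^ Suc k\<close>.\<close>
    have "(\<Sum>g\<le>Suc k. of_nat (Suc k choose g) * 1 ^ g * (-1) ^ (Suc k - g)) = (1 + (-1) :: rat) ^ Suc k"
      by (simp only: binomial_ring)
    then show ?thesis
      using 0 by (simp add: alt_binomial_sum_def mult_ac del: sum.atMost_Suc)
  next
    case (Suc j')
    then have j': "j' \<le> k" using Suc.prems by simp
    \<comment> \<open>After the shift the power is \<open>(g + 1) ^ j'\<close>; expanding it leaves
      exponents \<open>i \<le> j' \<le> k\<close>, all within reach of the induction
      hypothesis.\<close>
    have "alt_binomial_sum k (\<lambda>g. of_nat (Suc g) ^ j') =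
        alt_binomial_sum k (\<lambda>g. \<Sum>i\<le>j'. of_nat (j' choose i) * of_nat g ^ i)"
      by (simp add: binomial_ring[of "of_nat _" 1] add.commute[of 1])
    also have "\<dots> = (\<Sum>i\<le>j'. of_nat (j' choose i) * alt_binomial_sum k (\<lambda>g. of_nat g ^ i))"
      unfolding alt_binomial_sum_def sum_distrib_left
      by (subst sum.swap) (simp add: mult_ac)
    also have "\<dots> = (\<Sum>i\<le>j'. if i = k then of_nat (j' choose i) * fact k else 0)"
      by (intro sum.cong refl) (use Suc.IH j' in auto)
    also have "\<dots> = (if j' = k then fact k else 0)"
      using j' by auto
    finally show ?thesis
      using alt_binomial_sum_Suc[of k "\<lambda>g. of_nat g ^ j'"] Suc by simp
  qed
qed

text \<open>Differences divided by \<open>fact k\<close>: from the values at 0, ..., k of a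
  polynomial of degree at most k they read off the coefficient of \<open>x ^ k\<close>. Nothing is
  claimed for \<open>j > k\<close>, which \<open>grid_vanish\<close> has to work around.\<close>

lemma top_coeff_weights:
  obtains w :: "nat \<Rightarrow> nat \<Rightarrow> rat"
  where "\<And>j k. j \<le> k \<Longrightarrow> (\<Sum>g\<le>k. w k g * of_nat g ^ j) = (if j = k then 1 else 0)"
proof
  fix j k :: nat assume "j \<le> k"
  then show "(\<Sum>g\<le>k. ((-1) ^ (k - g) * of_nat (k choose g) / fact k) * of_nat g ^ j) =
      (if j = k then 1 else 0 :: rat)"
    using alt_binomial_sum_power[of j k]
    by (simp add: alt_binomial_sum_def divide_simps flip: sum_divide_distrib)
qed

lemma weight_superset: "finite S \<Longrightarrow> supp m \<subseteq> S \<Longrightarrow> weight m = (\<Sum>i\<in>S. coef m i)"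
  unfolding weight_def by (intro sum.mono_neutral_left) (auto simp: in_keys_iff)

lemma weight_le_imp_eq:
  assumes "\<And>i. coef m i \<le> coef m' i" "weight m' \<le> weight m"
  shows "m' = m"
proof (rule poly_mapping_eqI, rule ccontr)
  fix i assume ne: "coef m' i \<noteq> coef m i"
  let ?S = "supp m \<union> supp m'"
  have "coef m i < coef m' i" and i: "i \<in> ?S"
    using assms(1)[of i] ne by (auto simp: in_keys_iff)
  then have "\<exists>i\<in>?S. coef m i < coef m' i"
    by blast
  then have "(\<Sum>i\<in>?S. coef m i) < (\<Sum>i\<in>?S. coef m' i)"
    using assms(1) by (intro sum_strict_mono_ex1) simp_all
  then show False
    using assms(2) weight_superset[of ?S m] weight_superset[of ?S m'] by simp
qed

text \<open>Take \<open>m\<close> of maximal weight among the exponents with nonzero coefficient and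
  apply in each variable \<open>i\<close> the functional that extracts the power
  \<open>coef m i\<close>. By maximality every other such exponent has some entry smaller than that
  of \<open>m\<close>, and this one factor kills it, whatever larger entries do in the other
  factors. Only \<open>a m\<close> survives, although all values used lie on the grid below
  \<open>m\<close>, where the polynomial vanishes.\<close>

lemma grid_vanish:
  fixes a :: "expo \<Rightarrow> rat"
  assumes K: "finite K"
    and van: "\<And>m g. m \<in> K \<Longrightarrow> (\<And>i. g i \<le> coef m i) \<Longrightarrow> (\<Sum>m'\<in>K. a m' * mon (\<lambda>i. of_nat (g i)) m') = 0"
    and m0: "m0 \<in> K"
  shows "a m0 = 0"
proof (rule ccontr)
  assume "a m0 \<noteq> 0"
  let ?K = "{m\<in>K. a m \<noteq> 0}"
  obtain w :: "nat \<Rightarrow> nat \<Rightarrow> rat"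
    where w: "\<And>j k. j \<le> k \<Longrightarrow> (\<Sum>g\<le>k. w k g * of_nat g ^ j) = (if j = k then 1 else 0)"
    using top_coeff_weights by metis
  have "m0 \<in> ?K" using m0 \<open>a m0 \<noteq> 0\<close> by simp
  then have "Max (weight ` ?K) \<in> weight ` ?K"
    using K by (intro Max_in) auto
  then obtain m where "Max (weight ` ?K) = weight m" and m: "m \<in> ?K"
    by (rule imageE)
  then have max: "weight m' \<le> weight m" if "m' \<in> ?K" for m'
    using Max_ge[of "weight ` ?K" "weight m'"] K that by simp
  define I where "I = (\<Union>m\<in>K. supp m)"
  have I: "finite I" using K by (simp add: I_def)
  have monI: "mon v m' = (\<Prod>i\<in>I. v i ^ coef m' i)" if "m' \<in> K" for v :: "nat \<Rightarrow> rat" and m'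
    using that by (intro mon_superset I) (auto simp: I_def)
  have "0 = (\<Sum>g\<in>PiE I (\<lambda>i. {..coef m i}). (\<Prod>i\<in>I. w (coef m i) (g i)) *
      (\<Sum>m'\<in>K. a m' * (\<Prod>i\<in>I. of_nat (g i) ^ coef m' i)))"
  proof (intro sum.neutral[symmetric] ballI)
    fix g assume g: "g \<in> PiE I (\<lambda>i. {..coef m i})"
    \<comment> \<open>Members of \<open>PiE\<close> are \<open>undefined\<close> outside
      \<open>I\<close>, so \<open>g\<close> is continued by 0 in order to lie below
      \<open>coef m\<close> everywhere.\<close>
    have "(\<Sum>m'\<in>K. a m' * (\<Prod>i\<in>I. of_nat (g i) ^ coef m' i)) =
        (\<Sum>m'\<in>K. a m' * mon (\<lambda>i. of_nat (if i \<in> I then g i else 0)) m')"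
      by (intro sum.cong refl) (simp add: monI)
    also have "\<dots> = 0"
      by (rule van[of m]) (use m g in \<open>auto simp: PiE_iff\<close>)
    finally show "(\<Prod>i\<in>I. w (coef m i) (g i)) *
      (\<Sum>m'\<in>K. a m' * (\<Prod>i\<in>I. of_nat (g i) ^ coef m' i)) = 0" by simp
  qed
  also have "\<dots> = (\<Sum>m'\<in>K. a m' * (\<Sum>g\<in>PiE I (\<lambda>i. {..coef m i}).
      (\<Prod>i\<in>I. w (coef m i) (g i) * of_nat (g i) ^ coef m' i)))"
    unfolding sum_distrib_left by (subst sum.swap) (simp add: prod.distrib mult_ac)
  also have "\<dots> = (\<Sum>m'\<in>K. a m' * (\<Prod>i\<in>I. \<Sum>h\<le>coef m i. w (coef m i) h * of_nat h ^ coef m' i))"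
    by (subst prod_sum_PiE) (use I in auto)
  also have "\<dots> = (\<Sum>m'\<in>K. if m' = m then a m' else 0)"
  proof (intro sum.cong refl)
    fix m' assume m': "m' \<in> K"
    show "a m' * (\<Prod>i\<in>I. \<Sum>h\<le>coef m i. w (coef m i) h * of_nat h ^ coef m' i) =
        (if m' = m then a m' else 0)"
    proof (cases "m' = m \<or> a m' = 0")
      case True
      then show ?thesis by (auto simp: w)
    next
      case False
      then have "weight m' \<le> weight m" using max m' by simp
      then obtain i where i: "coef m' i < coef m i"
        using weight_le_imp_eq[of m m'] False by (meson leI)
      then have "i \<in> supp m" by (simp add: in_keys_iff)
      then have "i \<in> I" using m by (auto simp: I_def)
      moreover have "(\<Sum>h\<le>coef m i. w (coef m i) h * of_nat h ^ coef m' i) = 0"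
        using i by (simp add: w)
      ultimately show ?thesis
        using False I by (auto intro!: prod_zero)
    qed
  qed
  also have "\<dots> = a m"
    using m K by simp
  finally show False using m by simp
qed

section \<open>Clearing denominators and powers of r\<close>

lemma clear_denominators:
  fixes c :: "'a \<Rightarrow> ratfun"
  assumes "finite S"
  obtains d :: "rat poly" and p where "d \<noteq> 0" "\<And>m. m \<in> S \<Longrightarrow> c m * to_fract d = to_fract (p m)"
proof -
  have "\<exists>d p. d \<noteq> 0 \<and> (\<forall>m\<in>S. c m * to_fract d = to_fract (p m))"
    using assms
  proof (induction S rule: finite_induct)
    case empty
    show ?case by (rule exI[of _ 1]) simp
  next
    case (insert x S)
    then obtain d p where d: "d \<noteq> 0" and p: "\<And>m. m \<in> S \<Longrightarrow> c m * to_fract d = to_fract (p m)"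
      by auto
    obtain a b where ab: "c x = Fract a b" "b \<noteq> 0"
      by (cases "c x") auto
    have "c m * to_fract (d * b) = to_fract (if m = x then a * d else p m * b)" if "m \<in> insert x S" for m
    proof (cases "m = x")
      case True
      then show ?thesis using ab by (simp add: Fract_conv_to_fract)
    next
      case False
      then show ?thesis using p[of m] that by (simp flip: mult.assoc)
    qed
    then show ?case
      using d ab by (intro exI[of _ "d * b"] exI[of _ "\<lambda>m. if m = x then a * d else p m * b"]) simp
  qed
  then show ?thesis using that by blast
qed

text \<open>Clear denominators, then divide by the highest power of r common to all numerators. An
  index \<open>m1\<close> of least order at 0 loses its whole power of r, so its numerator survives
  at r = 0.\<close>

lemma regular_multiple:
  fixes c :: "'a \<Rightarrow> ratfun"
  assumes S: "finite S" and m0: "m0 \<in> S" "c m0 \<noteq> 0"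
  obtains e and p :: "'a \<Rightarrow> rat poly" and m1
  where "\<And>m. m \<in> S \<Longrightarrow> c m * e = to_fract (p m)" "m1 \<in> S" "poly (p m1) 0 \<noteq> 0"
proof -
  obtain d p where d: "d \<noteq> 0" and p: "\<And>m. m \<in> S \<Longrightarrow> c m * to_fract d = to_fract (p m)"
    using clear_denominators[OF S] by metis
  let ?S = "{m\<in>S. p m \<noteq> 0}"
  have "m0 \<in> ?S" using p[OF m0(1)] m0 d by auto
  then obtain m1 where m1: "m1 \<in> ?S" and min: "\<And>m. m \<in> ?S \<Longrightarrow> order 0 (p m1) \<le> order 0 (p m)"
    using ex_has_least_nat[of "\<lambda>m. m \<in> ?S" m0 "\<lambda>m. order 0 (p m)"] by blast
  \<comment> \<open>The polynomial r is written \<open>[:- 0, 1:]\<close> to match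
    \<open>order_divides\<close>.\<close>
  define q where "q = [:- 0, 1 :: rat:] ^ order 0 (p m1)"
  have q0: "q \<noteq> 0" by (simp add: q_def)
  have qd: "q dvd p m" if "m \<in> S" for m
    unfolding q_def order_divides using min that by auto
  have "poly (p m1 div q) 0 \<noteq> 0"
  proof
    assume "poly (p m1 div q) 0 = 0"
    then have "[:- 0, 1:] dvd p m1 div q" by (simp add: poly_eq_0_iff_dvd)
    then have "q * [:- 0, 1:] dvd q * (p m1 div q)" by (rule mult_dvd_mono[OF dvd_refl])
    then have "[:- 0, 1:] ^ Suc (order 0 (p m1)) dvd p m1"
      using qd[of m1] m1 by (simp add: q_def mult.commute)
    then show False unfolding order_divides using m1 by simp
  qed
  moreover have "c m * (to_fract d / to_fract q) = to_fract (p m div q)" if "m \<in> S" for m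
  proof -
    have "to_fract (p m) = to_fract (p m div q) * to_fract q"
      using qd[OF that] by (simp flip: to_fract_mult)
    then show ?thesis using p[OF that] q0 by (simp add: field_simps)
  qed
  moreover have "m1 \<in> S" using m1 by simp
  ultimately show ?thesis by (intro that)
qed

lemma r_ind_conv: "r_ind = to_fract [:0, 1:]"
  by (simp add: r_ind_def Fract_conv_to_fract)

lemma of_nat_to_fract: "of_nat k = to_fract (of_nat k)"
  by (induction k) auto

lemma to_fract_mon: "mon (\<lambda>i. to_fract (v i)) m = to_fract (mon v m)"
  by (induction m rule: expo_induct) (simp_all only: mon_0 mon_add mon_single to_fract_1 to_fract_mult)

lemma poly_mon: "poly (mon v m) a = mon (\<lambda>i. poly (v i) a) m"
  by (induction m rule: expo_induct) (simp_all only: mon_0 mon_add mon_single poly_1 poly_mult)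

text \<open>After multiplication by a suitable scalar, $f$ has a nonzero specialization at $r=0$. The
  specialization vanishes on integral points, so it is zero by the finite difference formula.\<close>

lemma zero_of_vanishing_below_supp:
  fixes f :: mpoly
  assumes van: "\<And>m \<gamma>. m \<in> supp f \<Longrightarrow> (\<And>i. coef \<gamma> i \<le> coef m i) \<Longrightarrow>
      eval_at (\<lambda>i. of_nat (coef \<gamma> i) + r_ind * of_nat (k \<gamma> i)) f = 0"
  shows "f = 0"
proof (rule ccontr)
  assume "f \<noteq> 0"
  then obtain m0 where m0: "m0 \<in> supp f" by fastforce
  obtain e p m1 where p: "\<And>m. m \<in> supp f \<Longrightarrow> coef f m * e = to_fract (p m)"
    and m1: "m1 \<in> supp f" "poly (p m1) 0 \<noteq> (0::rat)"
    using regular_multiple[of "supp f" m0 "coef f"] m0 by (auto simp: in_keys_iff)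
  have "poly (p m1) 0 = 0"
  proof (rule grid_vanish[of "supp f" "\<lambda>m. poly (p m) 0"])
    fix m and g :: "nat \<Rightarrow> nat" assume m: "m \<in> supp f" and g: "\<And>i. g i \<le> coef m i"
    define \<gamma> where "\<gamma> = Abs_poly_mapping g"
    have "i \<in> supp m" if "g i \<noteq> 0" for i
      using g[of i] that by (simp add: in_keys_iff)
    then have "finite {i. g i \<noteq> 0}"
      using finite_subset[of "{i. g i \<noteq> 0}" "supp m"] by auto
    then have \<gamma>: "coef \<gamma> = g" by (simp add: \<gamma>_def)
    \<comment> \<open>Each coordinate is linear in r with constant term \<open>g i\<close>, so the
      offsets \<open>k\<close>, however they depend on \<gamma>, disappear at r = 0.\<close>
    define v :: "nat \<Rightarrow> rat poly" where "v i = [:of_nat (g i), of_nat (k \<gamma> i):]" for i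
    have v: "of_nat (coef \<gamma> i) + r_ind * of_nat (k \<gamma> i) = to_fract (v i)" for i
    proof -
      have "v i = of_nat (g i) + [:0, 1:] * of_nat (k \<gamma> i)"
        by (simp add: v_def of_nat_poly)
      then show ?thesis
        by (simp only: \<gamma> r_ind_conv of_nat_to_fract to_fract_add to_fract_mult)
    qed
    have "eval_at (\<lambda>i. to_fract (v i)) f = 0"
      unfolding v[symmetric] by (rule van[OF m]) (simp add: \<gamma> g)
    then have "0 = eval_at (\<lambda>i. to_fract (v i)) f * e"
      by simp
    also have "\<dots> = (\<Sum>m\<in>supp f. (coef f m * e) * to_fract (mon v m))"
      by (simp add: eval_at_lin lin_ext_def to_fract_mon sum_distrib_right sum_distrib_left mult_ac)
    also have "\<dots> = to_fract (\<Sum>m\<in>supp f. p m * mon v m)"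
      by (simp add: p)
    finally have "to_fract (\<Sum>m\<in>supp f. p m * mon v m) = 0"
      by (rule sym)
    then have "(\<Sum>m\<in>supp f. p m * mon v m) = 0"
      by (simp only: to_fract_eq_0_iff)
    then have "poly (\<Sum>m\<in>supp f. p m * mon v m) 0 = 0"
      by simp
    then show "(\<Sum>m'\<in>supp f. poly (p m') 0 * mon (\<lambda>i. of_nat (g i)) m') = 0"
      by (simp add: poly_sum poly_mon v_def)
  qed (use m1 in auto)
  then show False using m1 by simp
qed

section \<open>The points $\overline\gamma$\<close>

text \<open>The order of positions in which \<gamma> is sorted stably into decreasing order:
  \<open>k\<close> comes after \<open>i\<close>.\<close>

definition after :: "expo \<Rightarrow> nat \<Rightarrow> nat \<Rightarrow> bool" where
  "after \<gamma> k i \<longleftrightarrow> coef \<gamma> k < coef \<gamma> i \<or> (coef \<gamma> k = coef \<gamma> i \<and> i < k)"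

text \<open>This turns out to be the multiple of r in coordinate \<open>i\<close> of
  \<open>bar n \<gamma>\<close>.\<close>

definition rk :: "nat \<Rightarrow> expo \<Rightarrow> nat \<Rightarrow> nat" where
  "rk n \<gamma> i = card {k\<in>{1..n}. after \<gamma> k i}"

lemma rk_mono:
  assumes "after \<gamma> j i" "j \<in> {1..n}"
  shows "rk n \<gamma> j < rk n \<gamma> i"
  unfolding rk_def
proof (rule psubset_card_mono)
  have "after \<gamma> k i" if "after \<gamma> k j" for k
    using that assms(1) by (auto simp: after_def)
  moreover have "\<not> after \<gamma> j j" by (simp add: after_def)
  ultimately show "{k\<in>{1..n}. after \<gamma> k j} \<subset> {k\<in>{1..n}. after \<gamma> k i}"
    using assms by blast
qed simp

lemma rk_less:
  assumes "i \<in> {1..n}"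
  shows "rk n \<gamma> i < n"
proof -
  have "{k\<in>{1..n}. after \<gamma> k i} \<subseteq> {1..n} - {i}"
    by (auto simp: after_def)
  then have "rk n \<gamma> i \<le> card ({1..n} - {i})"
    unfolding rk_def by (intro card_mono) auto
  then show ?thesis using assms by auto
qed

lemma after_linear: "i \<noteq> j \<Longrightarrow> after \<gamma> i j \<or> after \<gamma> j i"
  by (auto simp: after_def)

section \<open>Sorting permutations and their inversions\<close>

definition sorting :: "nat \<Rightarrow> expo \<Rightarrow> (nat \<Rightarrow> nat) \<Rightarrow> bool" where
  "sorting n \<gamma> w \<longleftrightarrow> w permutes {1..n} \<and> is_partition n (perm_act (inv w) (coef \<gamma>))"

lemma sorting_alt:
  "sorting n \<gamma> w \<longleftrightarrow> w permutes {1..n} \<and>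
    (\<forall>i j. 1 \<le> i \<and> i \<le> j \<and> j \<le> n \<longrightarrow> coef \<gamma> (w j) \<le> coef \<gamma> (w i))"
  by (auto simp: sorting_def is_partition_def perm_act_def permutes_inv_inv)

definition inversions :: "nat \<Rightarrow> (nat \<Rightarrow> nat) \<Rightarrow> (nat \<times> nat) set" where
  "inversions n u = {(i, j). 1 \<le> i \<and> i < j \<and> j \<le> n \<and> u j < u i}"

definition ascents :: "nat \<Rightarrow> expo \<Rightarrow> (nat \<times> nat) set" where
  "ascents n \<gamma> = {(i, j). 1 \<le> i \<and> i < j \<and> j \<le> n \<and> coef \<gamma> i < coef \<gamma> j}"

lemma finite_pairs: "finite (inversions n u)" "finite (ascents n \<gamma>)"
  by (rule finite_subset[of _ "{1..n} \<times> {1..n}"]; auto simp: inversions_def ascents_def)+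

text \<open>An inversion \<open>(a, b)\<close> of \<open>w\<close> corresponds to the inversion
  \<open>(w b, w a)\<close> of the inverse. The latter is a pair of positions of \<gamma>, so it can
  be compared with the ascents of \<gamma>.\<close>

lemma perm_length_inv:
  assumes w: "w permutes {1..n}"
  shows "perm_length n w = card (inversions n (inv w))"
proof -
  have mem: "w i \<in> {1..n} \<longleftrightarrow> i \<in> {1..n}" and mem': "inv w i \<in> {1..n} \<longleftrightarrow> i \<in> {1..n}" for i
    using permutes_in_image[OF w] permutes_in_image[OF permutes_inv[OF w]] by auto
  have iw: "inv w (w i) = i" "w (inv w i) = i" for i
    using permutes_inverses[OF w] by auto
  have "bij_betw (\<lambda>(a, b). (w b, w a)) (inversions n w) (inversions n (inv w))"
  proof (rule bij_betw_byWitness[where f' = "\<lambda>(a, b). (inv w b, inv w a)"])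
    show "(\<lambda>(a, b). (w b, w a)) ` inversions n w \<subseteq> inversions n (inv w)"
      using mem by (fastforce simp: inversions_def iw)
    show "(\<lambda>(a, b). (inv w b, inv w a)) ` inversions n (inv w) \<subseteq> inversions n w"
      using mem' by (fastforce simp: inversions_def iw)
  qed (auto simp: iw)
  then show ?thesis
    using bij_betw_same_card unfolding perm_length_def inversions_def by blast
qed

text \<open>A larger entry further to the right has to be placed earlier in a decreasing
  arrangement.\<close>

lemma ascents_subset_inversions:
  assumes "sorting n \<gamma> w"
  shows "ascents n \<gamma> \<subseteq> inversions n (inv w)"
proof (clarsimp simp: ascents_def inversions_def)
  fix i j assume ij: "Suc 0 \<le> i" "i < j" "j \<le> n" "coef \<gamma> i < coef \<gamma> j"
  have w: "w permutes {1..n}" using assms by (simp add: sorting_def)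
  have mem: "inv w k \<in> {1..n}" if "k \<in> {1..n}" for k
    using permutes_in_image[OF permutes_inv[OF w]] that by simp
  show "inv w j < inv w i"
  proof (rule ccontr)
    assume "\<not> inv w j < inv w i"
    then have "coef \<gamma> (w (inv w j)) \<le> coef \<gamma> (w (inv w i))"
      using assms mem[of i] mem[of j] ij by (simp add: sorting_alt)
    then show False using ij permutes_inverses(1)[OF w] by simp
  qed
qed

lemma stable_sorting:
  obtains w where "sorting n \<gamma> w" "inversions n (inv w) \<subseteq> ascents n \<gamma>"
proof -
  \<comment> \<open>The place of \<open>i\<close> in the stable order, counted from 1: the last
    position has \<open>rk\<close> equal to 0 and goes to \<open>n\<close>.\<close>
  define \<rho> where "\<rho> i = (if i \<in> {1..n} then n - rk n \<gamma> i else i)" for i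
  have less: "\<rho> i < \<rho> j" if "after \<gamma> j i" "i \<in> {1..n}" "j \<in> {1..n}" for i j
    using rk_mono[OF that(1,3)] rk_less[OF that(2), of \<gamma>] that by (simp add: \<rho>_def)
  have inj: "inj_on \<rho> {1..n}"
  proof (rule inj_onI, rule ccontr)
    fix i j assume "i \<in> {1..n}" "j \<in> {1..n}" "\<rho> i = \<rho> j" "i \<noteq> j"
    then show False using less[of i j] less[of j i] after_linear[of i j \<gamma>] by auto
  qed
  have "\<rho> ` {1..n} \<subseteq> {1..n}"
  proof
    fix x assume "x \<in> \<rho> ` {1..n}"
    then obtain i where "i \<in> {1..n}" "x = n - rk n \<gamma> i" by (auto simp: \<rho>_def)
    then show "x \<in> {1..n}" using rk_less[of i n \<gamma>] by auto
  qed
  then have "bij_betw \<rho> {1..n} {1..n}"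
    using inj by (simp add: bij_betw_def endo_inj_surj)
  then have \<rho>: "\<rho> permutes {1..n}"
    by (rule bij_imp_permutes) (auto simp: \<rho>_def)
  have mem: "inv \<rho> i \<in> {1..n} \<longleftrightarrow> i \<in> {1..n}" for i
    using permutes_in_image[OF permutes_inv[OF \<rho>]] by simp
  have "sorting n \<gamma> (inv \<rho>)"
    unfolding sorting_alt
  proof (intro conjI allI impI permutes_inv[OF \<rho>])
    fix i j assume ij: "1 \<le> i \<and> i \<le> j \<and> j \<le> n"
    have "\<not> after \<gamma> (inv \<rho> i) (inv \<rho> j)"
      using less[of "inv \<rho> i" "inv \<rho> j"] less[of "inv \<rho> j" "inv \<rho> i"] mem[of i] mem[of j] ij permutes_inverses[OF \<rho>]
      by auto
    then show "coef \<gamma> (inv \<rho> j) \<le> coef \<gamma> (inv \<rho> i)"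
      by (auto simp: after_def)
  qed
  moreover have "inversions n \<rho> \<subseteq> ascents n \<gamma>"
  proof (clarsimp simp: inversions_def ascents_def)
    fix i j assume ij: "Suc 0 \<le> i" "i < j" "j \<le> n" "\<rho> j < \<rho> i"
    then have mem: "i \<in> {1..n}" "j \<in> {1..n}" by auto
    have "\<not> after \<gamma> j i" using less[OF _ mem] ij(4) by auto
    then have "after \<gamma> i j" using ij after_linear[of i j] by auto
    then show "coef \<gamma> i < coef \<gamma> j" using ij by (auto simp: after_def)
  qed
  ultimately show ?thesis
    using that[of "inv \<rho>"] by (simp add: permutes_inv_inv[OF \<rho>])
qed

text \<open>Every sorting permutation inverts all ascents, so the shortest one inverts nothing else:
  it sorts stably.\<close>

lemma w_min_inversions:
  "sorting n \<gamma> (w_min n \<gamma>)" "inversions n (inv (w_min n \<gamma>)) = ascents n \<gamma>"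
proof -
  obtain w where w: "sorting n \<gamma> w" "inversions n (inv w) \<subseteq> ascents n \<gamma>"
    using stable_sorting by blast
  have wm: "w_min n \<gamma> = arg_min (perm_length n) (sorting n \<gamma>)"
    by (simp add: w_min_def sorting_def[abs_def])
  note min = arg_min_nat_lemma[of "sorting n \<gamma>", OF w(1), of "perm_length n", folded wm]
  show s: "sorting n \<gamma> (w_min n \<gamma>)"
    using min by simp
  have "card (inversions n (inv (w_min n \<gamma>))) \<le> card (inversions n (inv w))"
    using min w(1) s by (simp add: perm_length_inv[symmetric] sorting_def)
  also have "\<dots> \<le> card (ascents n \<gamma>)"
    using w(2) by (intro card_mono finite_pairs)
  finally show "inversions n (inv (w_min n \<gamma>)) = ascents n \<gamma>"
    using ascents_subset_inversions[OF s] card_seteq[OF finite_pairs(1)] by metis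
qed

lemma bar_alt: "bar n \<gamma> i = of_nat (coef \<gamma> i) + r_ind * of_nat (n - inv (w_min n \<gamma>) i)"
  by (simp add: bar_def perm_act_def delta_def)

text \<open>For \<open>u = inv (w_min n \<gamma>)\<close> the inversion set decides which of any two
  values of \<open>u\<close> is smaller, so \<open>u\<close> is increasing for the stable order.
  Hence \<open>n - u i\<close>, the number of values beyond \<open>u i\<close>, counts the positions
  sorted after \<open>i\<close>.\<close>

lemma bar_rk:
  assumes i: "i \<in> {1..n}"
  shows "bar n \<gamma> i = of_nat (coef \<gamma> i) + r_ind * of_nat (rk n \<gamma> i)"
proof -
  let ?w = "w_min n \<gamma>" let ?u = "inv ?w"
  have w: "?w permutes {1..n}" using w_min_inversions(1)[of n \<gamma>] by (simp add: sorting_def)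
  have u: "?u permutes {1..n}" by (rule permutes_inv[OF w])
  have mem: "?u k \<in> {1..n} \<longleftrightarrow> k \<in> {1..n}" for k by (rule permutes_in_image[OF u])
  have inj: "inj ?u" by (rule permutes_inj[OF u])
  have iff: "?u i < ?u k \<longleftrightarrow> after \<gamma> k i" if k: "k \<in> {1..n}" for k
  proof -
    have 1: "?u b < ?u a \<longleftrightarrow> coef \<gamma> a < coef \<gamma> b" if "a \<in> {1..n}" "b \<in> {1..n}" "a < b" for a b
    proof -
      have "(a, b) \<in> inversions n ?u \<longleftrightarrow> (a, b) \<in> ascents n \<gamma>"
        by (simp add: w_min_inversions(2))
      then show ?thesis using that by (simp add: inversions_def ascents_def)
    qed
    show ?thesis
    proof (cases "i < k")
      case True
      have "?u i \<noteq> ?u k" using inj True by (metis injD less_irrefl)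
      then have "?u i < ?u k \<longleftrightarrow> \<not> ?u k < ?u i" by linarith
      then show ?thesis using 1[OF i k True] True by (auto simp: after_def)
    next
      case False
      then show ?thesis using 1[OF k i] by (cases "i = k") (auto simp: after_def)
    qed
  qed
  have "{?u i<..n} = ?u ` {k\<in>{1..n}. after \<gamma> k i}"
  proof (intro equalityI subsetI)
    fix x assume x: "x \<in> {?u i<..n}"
    have ux: "?u (?w x) = x" by (rule permutes_inverses(2)[OF w])
    have "x \<in> {1..n}" using x mem[of i] i by simp
    then have "?w x \<in> {1..n}" using mem[of "?w x"] ux by simp
    moreover have "after \<gamma> (?w x) i" using iff[OF \<open>?w x \<in> {1..n}\<close>] x ux by simp
    ultimately show "x \<in> ?u ` {k\<in>{1..n}. after \<gamma> k i}" using ux by (metis (mono_tags, lifting) image_eqI mem_Collect_eq)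
  next
    fix x assume "x \<in> ?u ` {k\<in>{1..n}. after \<gamma> k i}"
    then obtain k where k: "k \<in> {1..n}" "after \<gamma> k i" "x = ?u k" by auto
    then show "x \<in> {?u i<..n}" using iff[of k] mem[of k] by simp
  qed
  then have "n - ?u i = card (?u ` {k\<in>{1..n}. after \<gamma> k i})"
    by (metis card_greaterThanAtMost)
  also have "\<dots> = rk n \<gamma> i"
    unfolding rk_def by (rule card_image) (rule inj_on_subset[OF inj], simp)
  finally show ?thesis by (simp add: bar_alt)
qed

section \<open>Behaviour of the points under swap and rotation\<close>

lemma rk_image:
  assumes \<pi>: "bij_betw \<pi> {1..n} {1..n}"
    and iff: "\<And>k. k \<in> {1..n} \<Longrightarrow> after \<gamma> (\<pi> k) (\<pi> i) \<longleftrightarrow> after \<gamma>' k i"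
  shows "rk n \<gamma> (\<pi> i) = rk n \<gamma>' i"
proof -
  have "{k\<in>{1..n}. after \<gamma> k (\<pi> i)} = \<pi> ` {k\<in>{1..n}. after \<gamma>' k i}"
  proof (intro equalityI subsetI)
    fix x assume x: "x \<in> {k\<in>{1..n}. after \<gamma> k (\<pi> i)}"
    then have "x \<in> \<pi> ` {1..n}" using \<pi> by (simp add: bij_betw_def)
    then obtain k where "x = \<pi> k" "k \<in> {1..n}" by (rule imageE)
    then show "x \<in> \<pi> ` {k\<in>{1..n}. after \<gamma>' k i}" using iff x by auto
  next
    fix x assume "x \<in> \<pi> ` {k\<in>{1..n}. after \<gamma>' k i}"
    then obtain k where k: "k \<in> {1..n}" "after \<gamma>' k i" "x = \<pi> k" by auto
    then show "x \<in> {k\<in>{1..n}. after \<gamma> k (\<pi> i)}"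
      using iff bij_betwE[OF \<pi>] by auto
  qed
  moreover have "inj_on \<pi> {k\<in>{1..n}. after \<gamma>' k i}"
    using \<pi> by (auto simp: bij_betw_def intro: inj_on_subset)
  ultimately show ?thesis
    unfolding rk_def by (simp add: card_image)
qed

text \<open>A last entry 0 has nothing sorted after it. This annihilates the factor
  \<open>x_n\<close> of the rotation.\<close>

lemma bar_last_zero:
  assumes "n \<ge> 1" "coef \<gamma> n = 0"
  shows "bar n \<gamma> n = 0"
proof -
  have "{k\<in>{1..n}. after \<gamma> k n} = {}"
    using assms by (auto simp: after_def)
  then have "rk n \<gamma> n = 0" by (simp add: rk_def)
  then show ?thesis using assms by (simp add: bar_rk)
qed

text \<open>Equal neighbours are consecutive in the stable order, so the numbers of positions behind
  them differ by one. The difference of coordinates is then exactly the parameter in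
  \<open>sigma_minus\<close>.\<close>

lemma bar_adjacent_equal:
  assumes i: "i \<in> {1..n-1}" and eq: "coef \<gamma> i = coef \<gamma> (Suc i)"
  shows "bar n \<gamma> i - bar n \<gamma> (Suc i) = r_ind"
proof -
  have "{k\<in>{1..n}. after \<gamma> k i} = insert (Suc i) {k\<in>{1..n}. after \<gamma> k (Suc i)}"
    using i eq by (auto simp: after_def)
  then have "rk n \<gamma> i = Suc (rk n \<gamma> (Suc i))"
    unfolding rk_def by (simp add: after_def)
  moreover have "i \<in> {1..n}" "Suc i \<in> {1..n}" using i by auto
  ultimately show ?thesis
    using eq by (simp add: bar_rk algebra_simps)
qed

text \<open>Specialization at r = 0. It separates coordinates with different entries, and later
  shows that the factors of \<open>d_coeff\<close> are nonzero.\<close>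

lemma r_ind_independent:
  fixes a b k l :: nat
  assumes "of_nat a + r_ind * of_nat k = of_nat b + r_ind * of_nat l"
  shows "a = b"
proof -
  have "to_fract (of_nat a + [:0, 1:] * of_nat k) = to_fract (of_nat b + [:0, 1:] * of_nat l :: rat poly)"
    using assms by (simp only: r_ind_conv of_nat_to_fract to_fract_add to_fract_mult)
  then have "poly (of_nat a + [:0, 1:] * of_nat k) 0 = poly (of_nat b + [:0, 1:] * of_nat l :: rat poly) 0"
    by (simp only: to_fract_eq_iff)
  then show ?thesis by simp
qed

lemma bar_eq_imp: "bar n \<gamma> i = bar n \<gamma> j \<Longrightarrow> coef \<gamma> i = coef \<gamma> j"
  using r_ind_independent by (simp only: bar_alt)

text \<open>Positions are compared with each other only to break ties, and the swap reverses this
  comparison only for the pair \<open>i\<close>, \<open>Suc i\<close>, whose entries differ.\<close>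

lemma bar_transpose:
  assumes i: "i \<in> {1..n-1}" and ne: "coef \<gamma> i \<noteq> coef \<gamma> (Suc i)"
    and \<gamma>': "\<And>k. coef \<gamma>' k = coef \<gamma> (transpose i (Suc i) k)" and j: "j \<in> {1..n}"
  shows "bar n \<gamma>' j = bar n \<gamma> (transpose i (Suc i) j)"
proof -
  let ?t = "transpose i (Suc i)"
  have t: "?t permutes {1..n}"
    using i by (intro permutes_swap_id) auto
  have tj: "?t j \<in> {1..n}"
    using permutes_in_image[OF t] j by simp
  have "rk n \<gamma> (?t j) = rk n \<gamma>' j"
    by (intro rk_image permutes_imp_bij t)
       (use ne in \<open>auto simp: after_def \<gamma>' transpose_def\<close>)
  then show ?thesis
    using j tj by (simp add: bar_rk \<gamma>')
qed

text \<open>\<open>\<gamma> = (\<gamma>'\<^sub>2, \<dots>, \<gamma>'\<^sub>n, \<gamma>'\<^sub>1 + 1)\<close>.\<close>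

lemma bar_rotate:
  assumes n: "n \<ge> 1"
    and \<gamma>: "coef \<gamma> n = Suc (coef \<gamma>' 1)" "\<And>i. i \<in> {1..<n} \<Longrightarrow> coef \<gamma> i = coef \<gamma>' (Suc i)"
    and j: "j \<in> {1..n}"
  shows "bar n \<gamma>' j = (if j = 1 then bar n \<gamma> n - 1 else bar n \<gamma> (j - 1))"
proof -
  define \<pi> where "\<pi> k = (if k = 1 then n else k - 1)" for k :: nat
  have \<pi>: "bij_betw \<pi> {1..n} {1..n}"
    by (rule bij_betw_byWitness[where f' = "\<lambda>k. if k = n then 1 else Suc k"])
       (use n in \<open>auto simp: \<pi>_def\<close>)
  have g: "coef \<gamma> (\<pi> k) = (if k = 1 then Suc (coef \<gamma>' 1) else coef \<gamma>' k)" if "k \<in> {1..n}" for k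
  proof (cases "k = 1")
    case False
    then have "k - 1 \<in> {1..<n}" using that by (simp, arith)
    moreover have "Suc (k - 1) = k" using that by simp
    ultimately show ?thesis using False \<gamma>(2)[of "k - 1"] by (simp add: \<pi>_def)
  qed (simp add: \<pi>_def \<gamma>(1))
  have "rk n \<gamma> (\<pi> j) = rk n \<gamma>' j"
  proof (rule rk_image[OF \<pi>])
    fix k assume k: "k \<in> {1..n}"
    \<comment> \<open>Position 1 of \<gamma>' precedes its equals in the stable order, whereas
      position n of \<gamma> follows them. The added unit makes up for this: with
      \<open>a = coef \<gamma>' 1\<close>, the conditions \<open>coef \<gamma>' k \<le> a\<close>
      and \<open>coef \<gamma>' k < a + 1\<close> agree.\<close>
    show "after \<gamma> (\<pi> k) (\<pi> j) \<longleftrightarrow> after \<gamma>' k j"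
      unfolding after_def g[OF k] g[OF j] using j k by (auto simp: \<pi>_def)
  qed
  moreover have "\<pi> j \<in> {1..n}" using bij_betwE[OF \<pi>] j by blast
  ultimately have "bar n \<gamma> (\<pi> j) = of_nat (coef \<gamma> (\<pi> j)) + r_ind * of_nat (rk n \<gamma>' j)"
    by (simp add: bar_rk)
  then show ?thesis
    using j unfolding g[OF j] by (auto simp: \<pi>_def bar_rk)
qed

section \<open>Supports and degrees\<close>

definition supp_in :: "expo set \<Rightarrow> mpoly set" where
  "supp_in A = {f. supp f \<subseteq> A}"

abbreviation comp_less :: "nat \<Rightarrow> nat \<Rightarrow> expo set" where
  "comp_less n d \<equiv> {m \<in> compositions n. weight m < d}"

text \<open>The bound is strict, so that \<open>deg_less n 0\<close> is the zero space,
  \<open>deg_less n 1\<close> consists of the constants, and lower-order terms in degree 0 are no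
  special case.\<close>

abbreviation deg_less :: "nat \<Rightarrow> nat \<Rightarrow> mpoly set" where
  "deg_less n d \<equiv> supp_in (comp_less n d)"

abbreviation homogeneous :: "nat \<Rightarrow> nat \<Rightarrow> mpoly set" where
  "homogeneous n d \<equiv> supp_in {m \<in> compositions n. weight m = d}"

lemma polys_supp_in: "polys n = supp_in (compositions n)"
  by (simp add: polys_def supp_in_def)

lemma supp_in_add: "f \<in> supp_in A \<Longrightarrow> g \<in> supp_in A \<Longrightarrow> f + g \<in> supp_in A"
  using Poly_Mapping.keys_add[of f g] by (auto simp: supp_in_def)

lemma supp_in_0 [simp]: "0 \<in> supp_in A"
  by (simp add: supp_in_def)

lemma supp_in_uminus: "f \<in> supp_in A \<Longrightarrow> - f \<in> supp_in A"
  by (auto simp: supp_in_def in_keys_iff)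

lemma supp_in_diff: "f \<in> supp_in A \<Longrightarrow> g \<in> supp_in A \<Longrightarrow> f - g \<in> supp_in A"
  using supp_in_add[of f A "- g"] supp_in_uminus[of g A] by simp

lemma supp_in_Const: "f \<in> supp_in A \<Longrightarrow> Const a * f \<in> supp_in A"
  using supp_Const_mult[of a f] by (auto simp: supp_in_def)

lemma supp_in_sum: "(\<And>i. i \<in> S \<Longrightarrow> f i \<in> supp_in A) \<Longrightarrow> (\<Sum>i\<in>S. f i) \<in> supp_in A"
  by (induction S rule: infinite_finite_induct) (auto intro: supp_in_add)

lemma supp_in_mult:
  assumes "f \<in> supp_in A" "g \<in> supp_in B" "\<And>a b. a \<in> A \<Longrightarrow> b \<in> B \<Longrightarrow> a + b \<in> C"
  shows "f * g \<in> supp_in C"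
  using assms Poly_Mapping.keys_mult[of f g] unfolding supp_in_def by blast

lemma supp_in_mono: "f \<in> supp_in A \<Longrightarrow> A \<subseteq> B \<Longrightarrow> f \<in> supp_in B"
  by (auto simp: supp_in_def)

lemma supp_in_X: "m \<in> A \<Longrightarrow> X m \<in> supp_in A"
  by (simp add: supp_in_def)

lemma weight_add: "weight (m + m') = weight m + weight m'"
proof -
  let ?S = "supp m \<union> supp m'"
  have "weight (m + m') = (\<Sum>i\<in>?S. coef (m + m') i)"
    using Poly_Mapping.keys_add[of m m'] by (intro weight_superset) auto
  then show ?thesis
    by (simp add: lookup_add sum.distrib weight_superset[of ?S m] weight_superset[of ?S m'])
qed

lemma weight_0 [simp]: "weight 0 = 0" and weight_single [simp]: "weight (single i 1) = 1"
  by (simp_all add: weight_def)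

lemma compositions_add: "m \<in> compositions n \<Longrightarrow> m' \<in> compositions n \<Longrightarrow> m + m' \<in> compositions n"
  using Poly_Mapping.keys_add[of m m'] unfolding compositions_def by blast

lemma zero_in_compositions [simp]: "0 \<in> compositions n"
  by (simp add: compositions_def)

lemma single_in_compositions: "i \<in> {1..n} \<Longrightarrow> single i 1 \<in> compositions n"
  by (simp add: compositions_def)

lemma weight_compositions: "m \<in> compositions n \<Longrightarrow> weight m = (\<Sum>i\<in>{1..n}. coef m i)"
  by (intro weight_superset) (auto simp: compositions_def)

lemma deg_less_mult: "f \<in> deg_less n a \<Longrightarrow> g \<in> deg_less n b \<Longrightarrow> a + b \<le> Suc c \<Longrightarrow> f * g \<in> deg_less n c"
  by (erule supp_in_mult, assumption) (auto simp: compositions_add weight_add)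

lemma homogeneous_mult: "f \<in> homogeneous n a \<Longrightarrow> g \<in> homogeneous n b \<Longrightarrow> f * g \<in> homogeneous n (a + b)"
  by (erule supp_in_mult, assumption) (auto simp: compositions_add weight_add)

lemma deg_less_mono: "f \<in> deg_less n a \<Longrightarrow> a \<le> b \<Longrightarrow> f \<in> deg_less n b"
  by (erule supp_in_mono) auto

lemma deg_less_polys: "f \<in> deg_less n d \<Longrightarrow> f \<in> polys n"
  unfolding polys_supp_in by (erule supp_in_mono) auto

lemma homogeneous_deg_less: "f \<in> homogeneous n d \<Longrightarrow> f \<in> deg_less n (Suc d)"
  by (erule supp_in_mono) auto

lemma homogeneous_polys: "f \<in> homogeneous n d \<Longrightarrow> f \<in> polys n"
  unfolding polys_supp_in by (erule supp_in_mono) auto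

lemma homogeneous_deg_less_0: "f \<in> homogeneous n d \<Longrightarrow> f \<in> deg_less n d \<Longrightarrow> f = 0"
proof -
  assume "f \<in> homogeneous n d" "f \<in> deg_less n d"
  then have "supp f = {}" unfolding supp_in_def by blast
  then show "f = 0" by (metis in_keys_iff empty_iff lookup_zero poly_mapping_eqI)
qed

lemma Var_homogeneous: "i \<in> {1..n} \<Longrightarrow> Var i \<in> homogeneous n 1"
  unfolding X_single[symmetric] by (rule supp_in_X) (use single_in_compositions weight_single in blast)

lemma Var_deg_less: "i \<in> {1..n} \<Longrightarrow> Var i \<in> deg_less n 2"
  using homogeneous_deg_less[OF Var_homogeneous] by (simp add: numeral_2_eq_2)

lemma one_homogeneous: "1 \<in> homogeneous n 0"
  using supp_in_X[of 0 "{m \<in> compositions n. weight m = 0}"] by simp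

lemma one_deg_less: "1 \<in> deg_less n 1"
  using homogeneous_deg_less[OF one_homogeneous] by simp

lemma compositions_step:
  assumes "m + single i 1 \<in> compositions n"
  shows "m \<in> compositions n" "i \<in> {1..n}"
proof -
  have "supp m \<subseteq> supp (m + single i 1)" "i \<in> supp (m + single i 1)"
    by (auto simp: in_keys_iff lookup_add)
  then show "m \<in> compositions n" "i \<in> {1..n}"
    using assms unfolding compositions_def by blast+
qed

lemma composition_induct [consumes 1, case_names zero step]:
  assumes "m \<in> compositions n" "P 0"
    and "\<And>m i. m \<in> compositions n \<Longrightarrow> i \<in> {1..n} \<Longrightarrow> P m \<Longrightarrow> P (m + single i 1)"
  shows "P m"
  using assms(1)
proof (induction m rule: expo_induct)
  case (step m i)
  then show ?case using assms(3) compositions_step[OF step.prems] by blast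
qed (rule assms(2))

section \<open>Degrees under substitution\<close>

lemma subst_supp_in:
  assumes "\<And>m. m \<in> A \<Longrightarrow> mon p m \<in> supp_in B" "f \<in> supp_in A"
  shows "subst p f \<in> supp_in B"
  unfolding subst_lin lin_ext_def
proof (intro supp_in_sum supp_in_Const)
  fix m assume "m \<in> supp f"
  then show "mon p m \<in> supp_in B"
    using assms by (auto simp: supp_in_def[of A])
qed

lemma mon_deg_less:
  assumes "\<And>i. i \<in> {1..n} \<Longrightarrow> p i \<in> deg_less n 2" "m \<in> compositions n"
  shows "mon p m \<in> deg_less n (Suc (weight m))"
  using assms(2)
proof (induction rule: composition_induct)
  case zero
  then show ?case using one_deg_less by simp
next
  case (step m i)
  then show ?case
    unfolding mon_add mon_single weight_add weight_single
    by (intro deg_less_mult[OF _ assms(1)]) auto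
qed

lemma mon_homogeneous:
  assumes "\<And>i. i \<in> {1..n} \<Longrightarrow> p i \<in> homogeneous n 1" "m \<in> compositions n"
  shows "mon p m \<in> homogeneous n (weight m)"
  using assms(2)
proof (induction rule: composition_induct)
  case zero
  then show ?case using one_homogeneous by simp
next
  case (step m i)
  then show ?case
    unfolding mon_add mon_single weight_add weight_single
    by (intro homogeneous_mult assms(1))
qed

text \<open>The difference of products telescopes, and each term has a constant
  \<open>p i - q i\<close> in place of one factor of degree at most 1. For the rotation this means
  that the shift by 1 affects lower-order terms only.\<close>

lemma mon_diff_deg_less:
  assumes p: "\<And>i. i \<in> {1..n} \<Longrightarrow> p i \<in> deg_less n 2" and q: "\<And>i. i \<in> {1..n} \<Longrightarrow> q i \<in> deg_less n 2"
    and pq: "\<And>i. i \<in> {1..n} \<Longrightarrow> p i - q i \<in> deg_less n 1" and m: "m \<in> compositions n"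
  shows "mon p m - mon q m \<in> deg_less n (weight m)"
  using m
proof (induction rule: composition_induct)
  case (step m i)
  have "mon p (m + single i 1) - mon q (m + single i 1) =
      mon p m * (p i - q i) + (mon p m - mon q m) * q i"
    unfolding mon_add mon_single by (simp add: algebra_simps)
  also have "\<dots> \<in> deg_less n (weight (m + single i 1))"
    unfolding weight_add weight_single
    by (intro supp_in_add deg_less_mult[OF mon_deg_less[of n p, OF p step(1)] pq[OF step(2)]]
        deg_less_mult[OF step(3) q[OF step(2)]]) auto
  finally show ?case .
qed simp

lemma subst_deg_less:
  assumes "\<And>i. i \<in> {1..n} \<Longrightarrow> p i \<in> deg_less n 2" "f \<in> deg_less n d"
  shows "subst p f \<in> deg_less n d"
  using assms(2)
proof (rule subst_supp_in[rotated])
  fix m assume "m \<in> comp_less n d"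
  then show "mon p m \<in> deg_less n d"
    using deg_less_mono[OF mon_deg_less[of n p, OF assms(1)], of m d] by simp
qed

lemma subst_homogeneous:
  assumes "\<And>i. i \<in> {1..n} \<Longrightarrow> p i \<in> homogeneous n 1" "f \<in> homogeneous n d"
  shows "subst p f \<in> homogeneous n d"
  using assms(2)
proof (rule subst_supp_in[rotated])
  fix m assume "m \<in> {m \<in> compositions n. weight m = d}"
  then show "mon p m \<in> homogeneous n d"
    using mon_homogeneous[of n p m, OF assms(1)] by auto
qed

lemma polys_deg_less:
  assumes "f \<in> polys n"
  obtains d where "f \<in> deg_less n d"
proof
  show "f \<in> deg_less n (Suc (Max (weight ` supp f)))"
    using assms by (auto simp: polys_def supp_in_def less_Suc_eq_le)
qed

lemma subst_polys:
  assumes "\<And>i. i \<in> {1..n} \<Longrightarrow> p i \<in> deg_less n 2" "f \<in> polys n"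
  shows "subst p f \<in> polys n"
proof -
  obtain d where "f \<in> deg_less n d" using polys_deg_less[OF assms(2)] .
  then show ?thesis using deg_less_polys[OF subst_deg_less[of n p, OF assms(1)]] by simp
qed

lemma subst_diff_deg_less:
  assumes p: "\<And>i. i \<in> {1..n} \<Longrightarrow> p i \<in> deg_less n 2" and q: "\<And>i. i \<in> {1..n} \<Longrightarrow> q i \<in> deg_less n 2"
    and pq: "\<And>i. i \<in> {1..n} \<Longrightarrow> p i - q i \<in> deg_less n 1" and f: "f \<in> deg_less n (Suc d)"
  shows "subst p f - subst q f \<in> deg_less n d"
proof -
  have "subst p f - subst q f = (\<Sum>m\<in>supp f. Const (coef f m) * (mon p m - mon q m))"
    by (simp add: subst_lin lin_ext_def sum_subtractf algebra_simps)
  also have "\<dots> \<in> deg_less n d"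
  proof (intro supp_in_sum supp_in_Const)
    fix m assume "m \<in> supp f"
    then have "m \<in> compositions n" "weight m \<le> d" using f by (auto simp: supp_in_def)
    then show "mon p m - mon q m \<in> deg_less n d"
      using mon_diff_deg_less[of n p q, OF p q pq] deg_less_mono by blast
  qed
  finally show ?thesis .
qed

definition expo_of :: "nat \<Rightarrow> (nat \<Rightarrow> nat) \<Rightarrow> expo" where
  "expo_of n g = Abs_poly_mapping (\<lambda>i. if i \<in> {1..n} then g i else 0)"

lemma coef_expo_of: "coef (expo_of n g) i = (if i \<in> {1..n} then g i else 0)"
proof -
  have "finite {i. (if i \<in> {1..n} then g i else 0) \<noteq> 0}"
    by (rule finite_subset[of _ "{1..n}"]) auto
  then show ?thesis by (simp add: expo_of_def)
qed

lemma expo_of_compositions: "expo_of n g \<in> compositions n"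
  by (auto simp: compositions_def in_keys_iff coef_expo_of split: if_splits)

lemma weight_expo_of: "weight (expo_of n g) = (\<Sum>i\<in>{1..n}. g i)"
  by (simp add: weight_compositions[OF expo_of_compositions] coef_expo_of)

lemma coef_composition_outside: "m \<in> compositions n \<Longrightarrow> i \<notin> {1..n} \<Longrightarrow> coef m i = 0"
  unfolding compositions_def using in_keys_iff[of i m] by blast

lemma finite_comp_less: "finite (comp_less n d)"
proof (rule finite_subset)
  show "comp_less n d \<subseteq> expo_of n ` PiE {1..n} (\<lambda>_. {..d})"
  proof
    fix m assume m: "m \<in> comp_less n d"
    have "m = expo_of n (restrict (coef m) {1..n})"
      using m coef_composition_outside by (intro poly_mapping_eqI) (auto simp: coef_expo_of)
    moreover have "coef m i \<le> d" if "i \<in> {1..n}" for i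
      using member_le_sum[OF that, of "coef m"] m weight_compositions[of m n] by simp
    then have "restrict (coef m) {1..n} \<in> PiE {1..n} (\<lambda>_. {..d})"
      by auto
    ultimately show "m \<in> expo_of n ` PiE {1..n} (\<lambda>_. {..d})" by blast
  qed
qed (auto intro!: finite_imageI finite_PiE)

section \<open>Interpolation\<close>

text \<open>The set \<open>S\<close> indexes monomials as well as functionals, so injectivity yields
  surjectivity by a dimension count. The functionals stay abstract because one use has evaluations
  only, while another has a coefficient in place of one evaluation.\<close>

lemma square_system_solvable:
  fixes L :: "expo \<Rightarrow> mpoly \<Rightarrow> ratfun"
  assumes S: "finite S"
    and add: "\<And>\<gamma> f g. L \<gamma> (f + g) = L \<gamma> f + L \<gamma> g"
    and scale: "\<And>\<gamma> a f. L \<gamma> (Const a * f) = a * L \<gamma> f"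
    and inj: "\<And>f. f \<in> supp_in S \<Longrightarrow> (\<And>\<gamma>. \<gamma> \<in> S \<Longrightarrow> L \<gamma> f = 0) \<Longrightarrow> f = 0"
  obtains f where "f \<in> supp_in S" "\<And>\<gamma>. \<gamma> \<in> S \<Longrightarrow> L \<gamma> f = b \<gamma>"
proof -
  interpret V: vector_space "\<lambda>a (f::mpoly). Const a * f"
    by standard (simp_all add: Const_add Const_mult algebra_simps)
  \<comment> \<open>Storing the values as coefficients of a polynomial supported on \<open>S\<close>
    turns the system into a linear map from \<open>supp_in S\<close> to itself.\<close>
  define T where "T f = (\<Sum>\<gamma>\<in>S. single \<gamma> (L \<gamma> f))" for f
  have coef_T: "coef (T f) \<gamma> = L \<gamma> f" if "\<gamma> \<in> S" for f \<gamma>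
    using that S by (simp add: T_def lookup_sum lookup_single when_def)
  have T_in: "(\<Sum>\<gamma>\<in>S. single \<gamma> (g \<gamma>)) \<in> supp_in S" for g :: "expo \<Rightarrow> ratfun"
    by (rule supp_in_sum) (simp add: supp_in_def)
  interpret T: Vector_Spaces.linear "\<lambda>a (f::mpoly). Const a * f" "\<lambda>a (f::mpoly). Const a * f" T
    by standard (simp_all add: T_def add scale single_add sum.distrib sum_distrib_left Const_single)
  let ?B = "X ` S"
  have inj_X: "inj_on X S"
  proof (rule inj_onI)
    fix m m' assume "X m = X m'"
    then have "supp (X m) = supp (X m')" by simp
    then show "m = m'" by simp
  qed
  have sub: "V.subspace (supp_in S)"
    by (rule V.subspaceI) (auto intro: supp_in_add supp_in_Const)
  have span: "V.span ?B = supp_in S"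
  proof
    show "V.span ?B \<subseteq> supp_in S"
      by (intro V.span_minimal sub) (auto intro: supp_in_X)
    show "supp_in S \<subseteq> V.span ?B"
    proof
      fix f assume "f \<in> supp_in S"
      then have "Const (coef f m) * X m \<in> V.span ?B" if "m \<in> supp f" for m
        using that by (intro V.span_scale V.span_base) (auto simp: supp_in_def)
      then have "(\<Sum>m\<in>supp f. Const (coef f m) * X m) \<in> V.span ?B"
        by (rule V.span_sum)
      then show "f \<in> V.span ?B"
        by (simp only: mpoly_sum_X[symmetric])
    qed
  qed
  have ind: "V.independent ?B"
  proof (rule V.independent_if_scalars_zero)
    fix u x assume 0: "(\<Sum>x\<in>?B. Const (u x) * x) = 0" and "x \<in> ?B"
    then obtain m where m: "m \<in> S" "x = X m" by auto
    have "0 = coef (\<Sum>m'\<in>S. Const (u (X m')) * X m') m"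
      using 0 by (simp add: sum.reindex[OF inj_X])
    also have "\<dots> = u x"
      using m S by (simp add: lookup_sum Const_single lookup_single when_def)
    finally show "u x = 0" by simp
  qed (simp add: S)
  have "f = 0" if "f \<in> supp_in S" "T f = 0" for f
    using inj[OF that(1)] coef_T[of _ f] that(2) by simp
  then have T_inj: "inj_on T (V.span ?B)"
    using T.inj_on_iff_eq_0[OF sub] unfolding span by blast
  have indT: "V.independent (T ` ?B)"
    by (rule T.independent_inj_on_image[OF ind T_inj])
  have card: "card (T ` ?B) = card S"
    using T_inj V.span_superset[of ?B] inj_X by (metis card_image inj_on_subset)
  define y where "y = (\<Sum>\<gamma>\<in>S. single \<gamma> (b \<gamma>))"
  \<comment> \<open>Otherwise \<open>y\<close> and the images of the monomials would be
    \<open>card S + 1\<close> independent vectors in a space spanned by \<open>card S\<close>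
    vectors.\<close>
  have "y \<in> V.span (T ` ?B)"
  proof (rule ccontr)
    assume y: "y \<notin> V.span (T ` ?B)"
    have "T ` ?B \<subseteq> V.span ?B" "y \<in> V.span ?B"
      unfolding span by (auto simp: T_def y_def T_in)
    then have "card (insert y (T ` ?B)) \<le> card ?B"
      using V.independent_span_bound[of ?B "insert y (T ` ?B)"] V.independent_insertI[OF y indT] S by auto
    moreover have "y \<notin> T ` ?B" using y V.span_base[of y "T ` ?B"] by argo
    ultimately show False
      using S card card_image[OF inj_X] by simp
  qed
  then have "y \<in> T ` supp_in S"
    by (simp only: T.span_image span)
  then obtain f where f: "y = T f" "f \<in> supp_in S"
    by (rule imageE)
  have "L \<gamma> f = b \<gamma>" if "\<gamma> \<in> S" for \<gamma>
    using coef_T[OF that, of f] that S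
    unfolding f(1)[symmetric] by (simp add: y_def lookup_sum lookup_single when_def)
  then show ?thesis using f(2) by (intro that)
qed

lemma zero_of_vanishing_below:
  assumes "\<And>m \<gamma>. m \<in> supp f \<Longrightarrow> (\<And>i. coef \<gamma> i \<le> coef m i) \<Longrightarrow> eval_at (bar n \<gamma>) f = 0"
  shows "f = 0"
proof (rule zero_of_vanishing_below_supp)
  fix m \<gamma> assume "m \<in> supp f" "\<And>i. coef \<gamma> i \<le> coef m i"
  then show "eval_at (\<lambda>i. of_nat (coef \<gamma> i) + r_ind * of_nat (n - inv (w_min n \<gamma>) i)) f = 0"
    using assms[of m \<gamma>] by (simp add: bar_alt[abs_def])
qed

lemma composition_below:
  assumes "m \<in> compositions n" "\<And>i. coef \<gamma> i \<le> coef m i"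
  shows "\<gamma> \<in> compositions n" "weight \<gamma> \<le> weight m"
proof -
  have "supp \<gamma> \<subseteq> supp m"
    using assms(2) by (metis in_keys_iff le_zero_eq subsetI)
  then show \<gamma>: "\<gamma> \<in> compositions n"
    using assms(1) by (simp add: compositions_def)
  show "weight \<gamma> \<le> weight m"
    using assms(2) by (simp add: weight_compositions[OF \<gamma>] weight_compositions[OF assms(1)] sum_mono)
qed

definition vanishes :: "nat \<Rightarrow> nat \<Rightarrow> mpoly \<Rightarrow> bool" where
  "vanishes n d f \<longleftrightarrow> (\<forall>\<gamma>\<in>comp_less n d. eval_at (bar n \<gamma>) f = 0)"

text \<open>The set \<open>comp_less n d\<close> is closed under decreasing entries, so it contains
  every grid point below the support of \<open>f\<close>.\<close>

lemma vanishes_imp_0: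
  assumes "f \<in> deg_less n d" "vanishes n d f"
  shows "f = 0"
proof (rule zero_of_vanishing_below)
  fix m \<gamma> assume m: "m \<in> supp f" and le: "\<And>i. coef \<gamma> i \<le> coef m i"
  have "m \<in> comp_less n d" using m assms(1) by (auto simp: supp_in_def)
  then have "\<gamma> \<in> comp_less n d"
    using composition_below[of m n \<gamma>, OF _ le] by auto
  then show "eval_at (bar n \<gamma>) f = 0"
    using assms(2) by (simp add: vanishes_def)
qed

text \<open>Since \<eta> has the largest admissible weight, it lies below an exponent
  \<open>m\<close> of \<open>f\<close> only if \<open>m = \<eta>\<close>, and this exponent is ruled
  out by \<open>coef f \<eta> = 0\<close>. The value at \<open>bar n \<eta>\<close> is therefore
  never called upon.\<close>

lemma vanishes_except_imp_0:
  assumes \<eta>: "\<eta> \<in> compositions n" and f: "f \<in> deg_less n (Suc (weight \<eta>))" and "coef f \<eta> = 0"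
    and van: "\<And>\<gamma>. \<gamma> \<in> compositions n \<Longrightarrow> weight \<gamma> \<le> weight \<eta> \<Longrightarrow> \<gamma> \<noteq> \<eta> \<Longrightarrow> eval_at (bar n \<gamma>) f = 0"
  shows "f = 0"
proof (rule zero_of_vanishing_below)
  fix m \<gamma> assume m: "m \<in> supp f" and le: "\<And>i. coef \<gamma> i \<le> coef m i"
  have m': "m \<in> compositions n" "weight m \<le> weight \<eta>" using m f by (auto simp: supp_in_def)
  have "\<gamma> \<noteq> \<eta>"
    using weight_le_imp_eq[of \<eta> m] le m' m assms(3) by (auto simp: in_keys_iff)
  then show "eval_at (bar n \<gamma>) f = 0"
    using van composition_below[of m n \<gamma>, OF m'(1) le] m'(2) by auto
qed

section \<open>Inhomogeneous lifts\<close>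

definition is_lift :: "nat \<Rightarrow> nat \<Rightarrow> mpoly \<Rightarrow> mpoly \<Rightarrow> bool" where
  "is_lift n d g f \<longleftrightarrow> f - g \<in> deg_less n d \<and> vanishes n d f"

definition lift :: "nat \<Rightarrow> expo \<Rightarrow> mpoly" where
  "lift n m = (SOME f. is_lift n (weight m) (X m) f)"

abbreviation neg :: "mpoly \<Rightarrow> mpoly" where
  "neg \<equiv> subst (\<lambda>i. - Var i)"

lemma is_lift_unique:
  assumes "is_lift n d g f" "is_lift n d g f'"
  shows "f = f'"
proof -
  have "f - f' = (f - g) - (f' - g)" by simp
  also have "\<dots> \<in> deg_less n d"
    using assms unfolding is_lift_def by (blast intro: supp_in_diff[of "f - g" _ "f' - g"])
  finally have "f - f' = 0"
    using assms by (intro vanishes_imp_0[of _ n d]) (auto simp: is_lift_def vanishes_def eval_at_diff)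
  then show ?thesis by simp
qed

text \<open>A correction of degree below \<open>d\<close> is interpolated so as to cancel the values
  of \<open>g\<close>.\<close>

lemma is_lift_exists: "\<exists>f. is_lift n d g f"
proof -
  obtain h where h: "h \<in> deg_less n d"
    "\<And>\<gamma>. \<gamma> \<in> comp_less n d \<Longrightarrow> eval_at (bar n \<gamma>) h = - eval_at (bar n \<gamma>) g"
  proof (rule square_system_solvable[of "comp_less n d" "\<lambda>\<gamma>. eval_at (bar n \<gamma>)" "\<lambda>\<gamma>. - eval_at (bar n \<gamma>) g"])
    show "f = 0" if "f \<in> deg_less n d" "\<And>\<gamma>. \<gamma> \<in> comp_less n d \<Longrightarrow> eval_at (bar n \<gamma>) f = 0" for f
      using vanishes_imp_0[OF that(1)] that(2) by (simp add: vanishes_def)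
  qed (simp_all add: finite_comp_less eval_at_add eval_at_Const_mult)
  then have "is_lift n d g (h + g)"
    by (simp add: is_lift_def vanishes_def eval_at_add)
  then show ?thesis ..
qed

lemma is_lift_lift: "is_lift n (weight m) (X m) (lift n m)"
  unfolding lift_def by (rule someI_ex[OF is_lift_exists])

lemma is_lift_sum:
  assumes "\<And>i. i \<in> S \<Longrightarrow> is_lift n d (g i) (f i)"
  shows "is_lift n d (\<Sum>i\<in>S. Const (a i) * g i) (\<Sum>i\<in>S. Const (a i) * f i)"
  unfolding is_lift_def
proof
  have "(\<Sum>i\<in>S. Const (a i) * f i) - (\<Sum>i\<in>S. Const (a i) * g i) = (\<Sum>i\<in>S. Const (a i) * (f i - g i))"
    by (simp add: sum_subtractf right_diff_distrib)
  also have "\<dots> \<in> deg_less n d"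
  proof (intro supp_in_sum supp_in_Const)
    show "f i - g i \<in> deg_less n d" if "i \<in> S" for i
      using assms[OF that] by (simp only: is_lift_def)
  qed
  finally show "(\<Sum>i\<in>S. Const (a i) * f i) - (\<Sum>i\<in>S. Const (a i) * g i) \<in> deg_less n d" .
  show "vanishes n d (\<Sum>i\<in>S. Const (a i) * f i)"
    using assms by (simp add: is_lift_def vanishes_def eval_at_sum eval_at_Const_mult)
qed

lemma is_lift_deg_less:
  assumes "g \<in> homogeneous n d" "is_lift n d g f"
  shows "f \<in> deg_less n (Suc d)"
proof -
  have "f - g \<in> deg_less n (Suc d)"
    using assms(2) deg_less_mono[of "f - g" n d "Suc d"] by (simp add: is_lift_def)
  then have "(f - g) + g \<in> deg_less n (Suc d)"
    by (rule supp_in_add[OF _ homogeneous_deg_less[OF assms(1)]])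
  then show ?thesis by simp
qed

lemma X_homogeneous: "m \<in> compositions n \<Longrightarrow> X m \<in> homogeneous n (weight m)"
  by (rule supp_in_X) simp

lemma lift_polys: "m \<in> compositions n \<Longrightarrow> lift n m \<in> polys n"
  by (rule deg_less_polys[OF is_lift_deg_less[OF X_homogeneous is_lift_lift]])

lemma neg_polys: "f \<in> polys n \<Longrightarrow> neg f \<in> polys n"
  by (rule subst_polys[OF supp_in_uminus[OF Var_deg_less]])

text \<open>The candidate for \<open>Xi\<close>. Prescribing it on monomials makes linearity
  immediate, before the \<open>F_top n \<eta>\<close> are known to span.\<close>

definition lift_op :: "nat \<Rightarrow> mpoly \<Rightarrow> mpoly" where
  "lift_op n = lin_ext Const (\<lambda>m. Const ((-1) ^ weight m) * neg (lift n m))"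

text \<open>Combining the lifts of the monomials of \<open>g\<close> gives a lift of
  \<open>g\<close>, which is \<open>f\<close> by uniqueness; all these monomials carry the same
  sign.\<close>

lemma lift_op_homogeneous:
  assumes g: "g \<in> homogeneous n d" and f: "is_lift n d g f"
  shows "lift_op n g = Const ((-1) ^ d) * neg f"
proof -
  have w: "weight m = d" if "m \<in> supp g" for m
    using that g by (auto simp: supp_in_def)
  define f' where "f' = (\<Sum>m\<in>supp g. Const (coef g m) * lift n m)"
  have "is_lift n d (\<Sum>m\<in>supp g. Const (coef g m) * X m) f'"
    unfolding f'_def by (rule is_lift_sum) (metis is_lift_lift w)
  then have "is_lift n d g f'"
    by (simp only: mpoly_sum_X[symmetric])
  then have "f = f'" by (rule is_lift_unique[OF f])
  moreover have "lift_op n g = Const ((-1) ^ d) * neg f'"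
    unfolding lift_op_def lin_ext_def f'_def subst_sum subst_Const_mult sum_distrib_left
    by (intro sum.cong refl) (simp add: w mult.left_commute)
  ultimately show ?thesis by simp
qed

section \<open>Linear operators\<close>

lemma polys_add: "f \<in> polys n \<Longrightarrow> g \<in> polys n \<Longrightarrow> f + g \<in> polys n"
  and polys_Const: "f \<in> polys n \<Longrightarrow> Const a * f \<in> polys n"
  and polys_sum: "(\<And>i. i \<in> S \<Longrightarrow> h i \<in> polys n) \<Longrightarrow> (\<Sum>i\<in>S. h i) \<in> polys n"
  unfolding polys_supp_in by (fact supp_in_add supp_in_Const supp_in_sum)+

lemma polys_mult: "f \<in> polys n \<Longrightarrow> g \<in> polys n \<Longrightarrow> f * g \<in> polys n"
  unfolding polys_supp_in by (erule supp_in_mult) (auto intro: compositions_add)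

lemma X_polys: "m \<in> compositions n \<Longrightarrow> X m \<in> polys n"
  unfolding polys_supp_in by (rule supp_in_X)

lemma linear_op_sum:
  assumes T: "linear_op n T" and g: "\<And>i. i \<in> S \<Longrightarrow> g i \<in> polys n"
  shows "T (\<Sum>i\<in>S. Const (a i) * g i) = (\<Sum>i\<in>S. Const (a i) * T (g i))"
proof -
  have 0: "T 0 = 0"
    using T unfolding linear_op_def polys_supp_in by (metis Const_0 mult_zero_left supp_in_0)
  show ?thesis
    using g
  proof (induction S rule: infinite_finite_induct)
    case (insert i S)
    then have "Const (a i) * g i \<in> polys n" "(\<Sum>i\<in>S. Const (a i) * g i) \<in> polys n"
      by (auto intro!: polys_Const polys_sum)
    then show ?case
      using T insert unfolding linear_op_def by simp
  qed (simp_all add: 0)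
qed

lemma linear_op_eqI:
  assumes "linear_op n T" "linear_op n U" "\<And>m. m \<in> compositions n \<Longrightarrow> T (X m) = U (X m)" "f \<in> polys n"
  shows "T f = U f"
proof -
  have m: "m \<in> compositions n" if "m \<in> supp f" for m
    using assms(4) that by (auto simp: polys_def)
  have "T (\<Sum>m\<in>supp f. Const (coef f m) * X m) = U (\<Sum>m\<in>supp f. Const (coef f m) * X m)"
    using m by (simp add: linear_op_sum[OF assms(1)] linear_op_sum[OF assms(2)] X_polys assms(3))
  then show ?thesis by (simp only: mpoly_sum_X[symmetric])
qed

lemma linear_op_comp:
  assumes "linear_op n U" "linear_op n T" "\<And>f. f \<in> polys n \<Longrightarrow> T f \<in> polys n"
  shows "linear_op n (\<lambda>f. U (T f))"
  using assms by (simp add: linear_op_def)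

lemma linear_op_lin_ext: "linear_op n (lin_ext Const h)"
  by (simp add: linear_op_def Const_hom.lin_ext_add Const_hom.lin_ext_Const_mult)

lemma linear_op_mult_subst: "linear_op n (\<lambda>f. g * subst p f)"
  by (simp add: linear_op_def subst_add subst_Const_mult distrib_left mult.left_commute)

lemma linear_op_subst: "linear_op n (subst p)"
  by (simp add: linear_op_def subst_add subst_Const_mult)

lemma linear_op_lift_op: "linear_op n (lift_op n)"
  unfolding lift_op_def by (rule linear_op_lin_ext)

lemma lift_op_polys: "f \<in> polys n \<Longrightarrow> lift_op n f \<in> polys n"
  unfolding lift_op_def lin_ext_def
  by (intro polys_sum polys_Const neg_polys lift_polys) (auto simp: polys_def)

section \<open>Identification of $\Xi$\<close>

lemma total_degree_eq:
  assumes "f \<in> deg_less n (Suc (weight \<eta>))" "coef f \<eta> \<noteq> 0"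
  shows "total_degree f = weight \<eta>"
  unfolding total_degree_def
proof (rule Max_eqI)
  show "weight \<eta> \<in> insert 0 (weight ` supp f)"
    using assms(2) by (auto simp: in_keys_iff)
  show "y \<le> weight \<eta>" if "y \<in> insert 0 (weight ` supp f)" for y
    using that assms(1) by (auto simp: supp_in_def)
qed simp

lemma polys_total_degree:
  assumes "f \<in> polys n"
  shows "f \<in> deg_less n (Suc (total_degree f))"
proof -
  have "weight m \<le> total_degree f" if "m \<in> supp f" for m
    unfolding total_degree_def using that by (intro Max_ge) auto
  then show ?thesis
    using assms by (auto simp: supp_in_def polys_def less_Suc_eq_le)
qed

lemma E_interp_spec:
  assumes \<eta>: "\<eta> \<in> compositions n"
  shows "E_interp n \<eta> \<in> polys n \<and> total_degree (E_interp n \<eta>) = weight \<eta> \<and>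
     (\<forall>\<gamma>\<in>compositions n. \<gamma> \<noteq> \<eta> \<and> weight \<gamma> \<le> weight \<eta> \<longrightarrow> eval_at (bar n \<gamma>) (E_interp n \<eta>) = 0) \<and>
     coef (E_interp n \<eta>) \<eta> = 1"
  unfolding E_interp_def
proof (rule theI')
  let ?P = "\<lambda>f. f \<in> polys n \<and> total_degree f = weight \<eta> \<and>
     (\<forall>\<gamma>\<in>compositions n. \<gamma> \<noteq> \<eta> \<and> weight \<gamma> \<le> weight \<eta> \<longrightarrow> eval_at (bar n \<gamma>) f = 0) \<and>
     coef f \<eta> = 1"
  let ?S = "comp_less n (Suc (weight \<eta>))"
  \<comment> \<open>The coefficient of \<open>x^\<eta>\<close> takes the place of the evaluation at
    \<open>bar n \<eta>\<close>, which makes the system square and includes the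
    normalization.\<close>
  let ?L = "\<lambda>\<gamma> f. if \<gamma> = \<eta> then coef f \<eta> else eval_at (bar n \<gamma>) f"
  obtain f where f: "f \<in> supp_in ?S" and L: "\<And>\<gamma>. \<gamma> \<in> ?S \<Longrightarrow> ?L \<gamma> f = (if \<gamma> = \<eta> then 1 else 0)"
  proof (rule square_system_solvable[of ?S ?L "\<lambda>\<gamma>. if \<gamma> = \<eta> then 1 else 0"])
    fix f assume f: "f \<in> supp_in ?S" and L: "\<And>\<gamma>. \<gamma> \<in> ?S \<Longrightarrow> ?L \<gamma> f = 0"
    show "f = 0"
    proof (rule vanishes_except_imp_0[OF \<eta> f])
      show "coef f \<eta> = 0" using L[of \<eta>] \<eta> by simp
      show "eval_at (bar n \<gamma>) f = 0" if "\<gamma> \<in> compositions n" "weight \<gamma> \<le> weight \<eta>" "\<gamma> \<noteq> \<eta>" for \<gamma>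
        using L[of \<gamma>] that by simp
    qed
  qed (simp_all add: finite_comp_less eval_at_add eval_at_Const_mult lookup_add)
  have 1: "coef f \<eta> = 1" using L[of \<eta>] \<eta> by simp
  have van: "eval_at (bar n \<gamma>) f = 0" if "\<gamma> \<in> compositions n" "\<gamma> \<noteq> \<eta> \<and> weight \<gamma> \<le> weight \<eta>" for \<gamma>
    using L[of \<gamma>] that by simp
  have "?P f"
  proof (intro conjI ballI impI 1)
    show "f \<in> polys n" by (rule deg_less_polys[OF f])
    show "total_degree f = weight \<eta>" by (rule total_degree_eq[OF f]) (simp add: 1)
    show "eval_at (bar n \<gamma>) f = 0" if "\<gamma> \<in> compositions n" "\<gamma> \<noteq> \<eta> \<and> weight \<gamma> \<le> weight \<eta>" for \<gamma>
      by (rule van[OF that])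
  qed
  moreover have "g = f" if "?P g" for g
  proof -
    have "g \<in> deg_less n (Suc (weight \<eta>))"
      using polys_total_degree[of g n] that by simp
    then have "g - f = 0"
      using that van 1 by (intro vanishes_except_imp_0[OF \<eta> supp_in_diff[OF _ f]])
        (simp_all add: eval_at_diff lookup_minus)
    then show ?thesis by simp
  qed
  ultimately show "\<exists>!f. ?P f" by blast
qed

section \<open>The interpolation polynomials as lifts of their leading parts\<close>

lemma coef_hom_component: "coef (hom_component d f) m = (if weight m = d then coef f m else 0)"
proof -
  have "coef (hom_component d f) m = (\<Sum>k | k \<in> supp f \<and> weight k = d. if k = m then coef f m else 0)"
    unfolding hom_component_def lookup_sum by (intro sum.cong refl) (auto simp: lookup_single when_def)
  then show ?thesis
    by (auto simp: in_keys_iff)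
qed

context
  fixes n :: nat and \<eta> :: expo
  assumes \<eta>: "\<eta> \<in> compositions n"
begin

lemma E_interp_deg_less: "E_interp n \<eta> \<in> deg_less n (Suc (weight \<eta>))"
  using polys_total_degree[of "E_interp n \<eta>" n] E_interp_spec[OF \<eta>] by simp

text \<open>Were this value zero too, the polynomial would vanish at all points up to its own degree
  and hence be zero. The value is the denominator of the coefficients in
  \<open>X_in_span_F_top\<close>.\<close>

lemma E_interp_eval_ne: "eval_at (bar n \<eta>) (E_interp n \<eta>) \<noteq> 0"
proof
  assume "eval_at (bar n \<eta>) (E_interp n \<eta>) = 0"
  then have "vanishes n (Suc (weight \<eta>)) (E_interp n \<eta>)"
    using E_interp_spec[OF \<eta>] unfolding vanishes_def by (metis (no_types, lifting) less_Suc_eq_le mem_Collect_eq)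
  then have "E_interp n \<eta> = 0"
    by (rule vanishes_imp_0[OF E_interp_deg_less])
  then show False using E_interp_spec[OF \<eta>] by (metis lookup_zero zero_neq_one)
qed

lemma coef_E_top: "coef (E_top n \<eta>) m = (if weight m = weight \<eta> then coef (E_interp n \<eta>) m else 0)"
  using E_interp_spec[OF \<eta>] by (simp add: E_top_def top_component_def coef_hom_component)

lemma E_top_homogeneous: "E_top n \<eta> \<in> homogeneous n (weight \<eta>)"
  unfolding supp_in_def
proof (intro CollectI subsetI)
  fix m assume "m \<in> supp (E_top n \<eta>)"
  then have "weight m = weight \<eta>" "m \<in> supp (E_interp n \<eta>)"
    by (simp_all add: in_keys_iff coef_E_top split: if_splits)
  moreover have "supp (E_interp n \<eta>) \<subseteq> compositions n"
    using E_interp_deg_less by (auto simp: supp_in_def)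
  ultimately show "m \<in> compositions n \<and> weight m = weight \<eta>" by blast
qed

lemma E_top_is_lift: "is_lift n (weight \<eta>) (E_top n \<eta>) (E_interp n \<eta>)"
  unfolding is_lift_def
proof
  show "E_interp n \<eta> - E_top n \<eta> \<in> deg_less n (weight \<eta>)"
  proof (unfold supp_in_def, intro CollectI subsetI)
    fix m assume "m \<in> supp (E_interp n \<eta> - E_top n \<eta>)"
    then have "weight m \<noteq> weight \<eta>" "m \<in> supp (E_interp n \<eta>)"
      by (auto simp: in_keys_iff lookup_minus coef_E_top split: if_splits)
    moreover have "m \<in> comp_less n (Suc (weight \<eta>))"
      using calculation(2) E_interp_deg_less by (auto simp: supp_in_def)
    ultimately show "m \<in> compositions n \<and> weight m < weight \<eta>" by auto
  qed
  show "vanishes n (weight \<eta>) (E_interp n \<eta>)"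
    using E_interp_spec[OF \<eta>] unfolding vanishes_def by auto
qed

lemma lift_op_F_top: "lift_op n (F_top n \<eta>) = F_interp n \<eta>"
proof -
  have "lift_op n (F_top n \<eta>) = Const (d_coeff n \<eta> alpha) * lift_op n (E_top n \<eta>)"
    by (simp add: F_top_def lift_op_def Const_hom.lin_ext_Const_mult)
  also have "\<dots> = F_interp n \<eta>"
    by (simp add: lift_op_homogeneous[OF E_top_homogeneous E_top_is_lift] F_interp_def Const_mult mult_ac)
  finally show ?thesis .
qed

lemma F_top_polys: "F_top n \<eta> \<in> polys n"
  unfolding F_top_def by (intro polys_Const homogeneous_polys[OF E_top_homogeneous])

end

lemma r_ind_ne_0: "r_ind \<noteq> 0"
  by (simp add: r_ind_conv)

text \<open>Multiplied by r, a factor with arm \<open>a\<close> and leg \<open>b\<close> becomes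
  \<open>(a + 1) + r * (b + 1)\<close>, whose constant term in r is positive.\<close>

lemma d_coeff_ne_0: "d_coeff n \<eta> alpha \<noteq> 0"
proof -
  have "alpha * (of_nat a + 1) + of_nat b + 1 \<noteq> 0" for a b
  proof
    assume 0: "alpha * (of_nat a + 1) + of_nat b + 1 = 0"
    have "r_ind * (alpha * (of_nat a + 1) + of_nat b + 1) = of_nat (Suc a) + r_ind * of_nat (Suc b)"
      using r_ind_ne_0 by (simp add: alpha_def field_simps)
    then have "of_nat (Suc a) + r_ind * of_nat (Suc b) = of_nat 0 + r_ind * of_nat 0"
      using 0 by simp
    then show False using r_ind_independent by blast
  qed
  then show ?thesis
    by (simp add: d_coeff_def)
qed

text \<open>Lagrange interpolation: a polynomial of degree at most \<open>weight m\<close> that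
  vanishes at the points of smaller weight is determined by its values at the points of weight
  \<open>weight m\<close>, and each \<open>E_interp n \<eta>\<close> in the sum is nonzero at
  exactly one of these. This expands the lift of \<open>x^m\<close>; leading parts then give the
  claim.\<close>

lemma X_in_span_F_top:
  assumes m: "m \<in> compositions n"
  obtains a where "X m = (\<Sum>\<eta> | \<eta> \<in> compositions n \<and> weight \<eta> = weight m. Const (a \<eta>) * F_top n \<eta>)"
proof -
  let ?d = "weight m" and ?S = "{\<eta> \<in> compositions n. weight \<eta> = weight m}"
  have fin: "finite ?S" by (rule finite_subset[OF _ finite_comp_less[of n "Suc ?d"]]) auto
  define c where "c \<eta> = eval_at (bar n \<eta>) (lift n m) / eval_at (bar n \<eta>) (E_interp n \<eta>)" for \<eta>
  define f where "f = (\<Sum>\<eta>\<in>?S. Const (c \<eta>) * E_interp n \<eta>)"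
  define g where "g = (\<Sum>\<eta>\<in>?S. Const (c \<eta>) * E_top n \<eta>)"
  have fg: "is_lift n ?d g f"
    unfolding f_def g_def
  proof (rule is_lift_sum)
    show "is_lift n ?d (E_top n \<eta>) (E_interp n \<eta>)" if "\<eta> \<in> ?S" for \<eta>
      using that E_top_is_lift[of \<eta> n] by simp
  qed
  have g: "g \<in> homogeneous n ?d"
    unfolding g_def
  proof (intro supp_in_sum supp_in_Const)
    show "E_top n \<eta> \<in> homogeneous n ?d" if "\<eta> \<in> ?S" for \<eta>
      using that E_top_homogeneous[of \<eta> n] by simp
  qed
  note L = is_lift_lift[of n m]
  have "lift n m - f = 0"
  proof (rule vanishes_imp_0)
    show "lift n m - f \<in> deg_less n (Suc ?d)"
      by (intro supp_in_diff is_lift_deg_less[OF X_homogeneous[OF m] L] is_lift_deg_less[OF g fg])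
    show "vanishes n (Suc ?d) (lift n m - f)"
      unfolding vanishes_def eval_at_diff
    proof
      fix \<gamma> assume \<gamma>: "\<gamma> \<in> comp_less n (Suc ?d)"
      show "eval_at (bar n \<gamma>) (lift n m) - eval_at (bar n \<gamma>) f = 0"
      proof (cases "weight \<gamma> = ?d")
        case True
        have "eval_at (bar n \<gamma>) f = (\<Sum>\<eta>\<in>?S. if \<eta> = \<gamma> then eval_at (bar n \<gamma>) (lift n m) else 0)"
          unfolding f_def eval_at_sum eval_at_Const_mult
          using \<gamma> True E_interp_spec E_interp_eval_ne by (intro sum.cong refl) (auto simp: c_def)
        then show ?thesis using fin \<gamma> True by simp
      next
        case False
        then have "\<gamma> \<in> comp_less n ?d" using \<gamma> by auto
        then show ?thesis using L fg by (simp add: is_lift_def vanishes_def)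
      qed
    qed
  qed
  then have f: "lift n m = f" by simp
  \<comment> \<open>Both \<open>X m\<close> and \<open>g\<close> are leading parts of the same
    polynomial, so they differ by something of lower degree that is also homogeneous of degree
    \<open>?d\<close>.\<close>
  have "X m - g = (f - g) - (lift n m - X m)"
    by (simp add: f)
  also have "\<dots> \<in> deg_less n ?d"
    using fg L unfolding is_lift_def by (blast intro: supp_in_diff[of "f - g" _ "lift n m - X m"])
  finally have "X m - g = 0"
    by (rule homogeneous_deg_less_0[OF supp_in_diff[OF X_homogeneous[OF m] g]])
  then have "X m = g" by simp
  also have "g = (\<Sum>\<eta>\<in>?S. Const (c \<eta> / d_coeff n \<eta> alpha) * F_top n \<eta>)"
    unfolding g_def
    by (intro sum.cong refl) (simp add: F_top_def d_coeff_ne_0 flip: mult.assoc Const_mult)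
  finally show ?thesis by (rule that)
qed

lemma lift_op_unique:
  assumes T: "linear_op n T" "\<And>\<eta>. \<eta> \<in> compositions n \<Longrightarrow> T (F_top n \<eta>) = F_interp n \<eta>"
    and f: "f \<in> polys n"
  shows "T f = lift_op n f"
proof (rule linear_op_eqI[OF T(1) linear_op_lift_op _ f])
  fix m assume m: "m \<in> compositions n"
  obtain a where a: "X m = (\<Sum>\<eta> | \<eta> \<in> compositions n \<and> weight \<eta> = weight m. Const (a \<eta>) * F_top n \<eta>)"
    using X_in_span_F_top[OF m] .
  have "U (X m) = (\<Sum>\<eta> | \<eta> \<in> compositions n \<and> weight \<eta> = weight m. Const (a \<eta>) * F_interp n \<eta>)"
    if U: "linear_op n U" "\<And>\<eta>. \<eta> \<in> compositions n \<Longrightarrow> U (F_top n \<eta>) = F_interp n \<eta>" for U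
    unfolding a by (subst linear_op_sum[OF U(1)]) (auto simp: F_top_polys U(2))
  from this[OF T] this[OF linear_op_lift_op lift_op_F_top]
  show "T (X m) = lift_op n (X m)"
    by (rule trans[OF _ sym])
qed

lemma Xi_eq:
  assumes "f \<in> polys n"
  shows "Xi n f = lift_op n f"
proof -
  \<comment> \<open>Restriction supplies the value \<open>undefined\<close> outside
    \<open>polys n\<close> that the extensional function space prescribes.\<close>
  have "Xi n = restrict (lift_op n) (polys n)"
    unfolding Xi_def
  proof (rule the_equality)
    have "linear_op n (restrict (lift_op n) (polys n))"
      using linear_op_lift_op[of n] by (auto simp: linear_op_def polys_add polys_Const)
    then show "restrict (lift_op n) (polys n) \<in> polys n \<rightarrow>\<^sub>E polys n \<and>
        linear_op n (restrict (lift_op n) (polys n)) \<and>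
        (\<forall>\<eta>\<in>compositions n. restrict (lift_op n) (polys n) (F_top n \<eta>) = F_interp n \<eta>)"
      by (auto simp: lift_op_polys F_top_polys lift_op_F_top)
  next
    fix T assume T: "T \<in> polys n \<rightarrow>\<^sub>E polys n \<and> linear_op n T \<and>
        (\<forall>\<eta>\<in>compositions n. T (F_top n \<eta>) = F_interp n \<eta>)"
    show "T = restrict (lift_op n) (polys n)"
    proof
      fix f show "T f = restrict (lift_op n) (polys n) f"
      proof (cases "f \<in> polys n")
        case True
        then show ?thesis using T lift_op_unique[of n T f] by simp
      next
        case False
        have "T f = undefined" using T False by (intro PiE_arb[of T]) blast+
        then show ?thesis using False by simp
      qed
    qed
  qed
  then show ?thesis using assms by simp
qed

section \<open>The affine rotation\<close>

definition Phi_minus :: "nat \<Rightarrow> mpoly \<Rightarrow> mpoly" where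
  "Phi_minus n f = Var n * subst (\<lambda>k. if k = 1 then Var n - 1 else Var (k - 1)) f"

text \<open>Negating the variables reverses the shift, and the outer sign comes from the factor
  \<open>x_n\<close>.\<close>

lemma Phi_plus_neg: "Phi_plus n (neg f) = - neg (Phi_minus n f)"
proof -
  have "(\<lambda>i. subst (\<lambda>k. if k = 1 then Var n + 1 else Var (k - 1)) (- Var i)) =
      (\<lambda>i. neg (if i = 1 then Var n - 1 else Var (i - 1)))"
    by (auto simp: fun_eq_iff subst_uminus subst_diff)
  then show ?thesis
    by (simp add: Phi_plus_def Phi_minus_def subst_subst subst_mult)
qed

lemma pred_mem: "k \<in> {1..n} \<Longrightarrow> k \<noteq> 1 \<Longrightarrow> k - 1 \<in> {1..n}" for k n :: nat
  by (simp, arith)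

lemma rotation_deg_less:
  assumes "n \<ge> 1" "c \<in> deg_less n 1" "k \<in> {1..n}"
  shows "(if k = 1 then Var n + c else Var (k - 1)) \<in> deg_less n 2"
proof -
  have "Var n + c \<in> deg_less n 2"
    using assms by (intro supp_in_add Var_deg_less deg_less_mono[OF assms(2)]) auto
  moreover have "Var (k - 1) \<in> deg_less n 2" if "k \<noteq> 1"
    by (rule Var_deg_less[OF pred_mem[OF assms(3) that]])
  ultimately show ?thesis by simp
qed

lemma Phi_homogeneous:
  assumes "n \<ge> 1" "g \<in> homogeneous n d"
  shows "Phi n g \<in> homogeneous n (Suc d)"
proof -
  have "subst (\<lambda>k. if k = 1 then Var n else Var (k - 1)) g \<in> homogeneous n d"
  proof (rule subst_homogeneous[OF _ assms(2)])
    show "(if k = 1 then Var n else Var (k - 1)) \<in> homogeneous n 1" if "k \<in> {1..n}" for k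
      using assms(1) Var_homogeneous[of n n] Var_homogeneous[OF pred_mem[OF that]] by simp
  qed
  then show ?thesis
    unfolding Phi_def using homogeneous_mult[OF Var_homogeneous[of n n]] assms(1) by simp
qed

lemma Phi_polys:
  assumes "n \<ge> 1" "f \<in> polys n"
  shows "Phi n f \<in> polys n"
proof -
  have "(if k = 1 then Var n else Var (k - 1)) \<in> deg_less n 2" if "k \<in> {1..n}" for k
    using rotation_deg_less[OF assms(1) supp_in_0 that] by (simp only: add_0_right)
  then show ?thesis
    unfolding Phi_def using assms
    by (intro polys_mult subst_polys deg_less_polys[OF Var_deg_less]) auto
qed

lemma eval_at_Phi_minus:
  "eval_at v (Phi_minus n f) = v n * eval_at (\<lambda>k. if k = 1 then v n - 1 else v (k - 1)) f"
proof -
  have "(\<lambda>i. eval_at v (if i = 1 then Var n - 1 else Var (i - 1))) =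
      (\<lambda>k. if k = 1 then v n - 1 else v (k - 1))"
    by (auto simp: fun_eq_iff eval_at_diff)
  then show ?thesis
    by (simp add: Phi_minus_def eval_at_mult eval_at_subst)
qed

lemma vanishes_Phi_minus:
  assumes n: "n \<ge> 1" and f: "f \<in> polys n" and van: "vanishes n d f"
  shows "vanishes n (Suc d) (Phi_minus n f)"
  unfolding vanishes_def
proof
  fix \<gamma> assume \<gamma>: "\<gamma> \<in> comp_less n (Suc d)"
  show "eval_at (bar n \<gamma>) (Phi_minus n f) = 0"
  proof (cases "coef \<gamma> n")
    case 0
    then show ?thesis using n by (simp add: eval_at_Phi_minus bar_last_zero)
  next
    case (Suc a)
    \<comment> \<open>This undoes the rotation: \<gamma>' is
      \<open>(\<gamma>_n - 1, \<gamma>_1, ..., \<gamma>_(n-1))\<close>, of weight one less than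
      \<gamma>.\<close>
    define \<gamma>' where "\<gamma>' = expo_of n (\<lambda>i. if i = 1 then a else coef \<gamma> (i - 1))"
    have c1: "coef \<gamma> n = Suc (coef \<gamma>' 1)"
      using Suc n by (simp add: \<gamma>'_def coef_expo_of)
    have c2: "coef \<gamma> i = coef \<gamma>' (Suc i)" if "i \<in> {1..<n}" for i
      using that by (simp add: \<gamma>'_def coef_expo_of)
    have "weight \<gamma> = (\<Sum>i=1..<n. coef \<gamma> i) + coef \<gamma> n"
      using \<gamma> n by (simp add: weight_compositions[of \<gamma> n] sum.last_plus add.commute atLeastLessThanSuc_atLeastAtMost flip: sum.last_plus)
    also have "(\<Sum>i=1..<n. coef \<gamma> i) = (\<Sum>i=Suc 1..<Suc n. coef \<gamma>' i)"
      unfolding sum.shift_bounds_Suc_ivl by (intro sum.cong refl c2)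
    also have "\<dots> + coef \<gamma> n = Suc (\<Sum>i=1..<Suc n. coef \<gamma>' i)"
      using n sum.atLeast_Suc_lessThan[of 1 "Suc n" "coef \<gamma>'"] c1 by linarith
    also have "\<dots> = Suc (weight \<gamma>')"
      unfolding atLeastLessThanSuc_atLeastAtMost
      using weight_compositions[of \<gamma>' n] by (simp add: \<gamma>'_def expo_of_compositions)
    finally have "\<gamma>' \<in> comp_less n d"
      using \<gamma> by (simp add: \<gamma>'_def expo_of_compositions)
    then have "eval_at (bar n \<gamma>') f = 0"
      using van by (simp add: vanishes_def)
    also have "eval_at (bar n \<gamma>') f = eval_at (\<lambda>k. if k = 1 then bar n \<gamma> n - 1 else bar n \<gamma> (k - 1)) f"
      by (rule eval_at_cong[OF f bar_rotate[OF n c1 c2]])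
    finally show ?thesis by (simp add: eval_at_Phi_minus)
  qed
qed

lemma is_lift_Phi:
  assumes n: "n \<ge> 1" and g: "g \<in> homogeneous n d" and f: "is_lift n d g f"
  shows "is_lift n (Suc d) (Phi n g) (Phi_minus n f)"
  unfolding is_lift_def
proof
  let ?p = "\<lambda>k. if k = 1 then Var n - 1 else Var (k - 1)"
  let ?q = "\<lambda>k. if k = 1 then Var n else Var (k - 1)"
  have fd: "f \<in> deg_less n (Suc d)" by (rule is_lift_deg_less[OF g f])
  have p: "?p k \<in> deg_less n 2" and q: "?q k \<in> deg_less n 2" and pq: "?p k - ?q k \<in> deg_less n 1"
    if "k \<in> {1..n}" for k
    using rotation_deg_less[OF n supp_in_uminus[OF one_deg_less] that]
      rotation_deg_less[OF n supp_in_0 that] supp_in_uminus[OF one_deg_less, of n] by auto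
  \<comment> \<open>Lower-order terms have two sources: the shift in \<open>?p\<close>, and the part
    \<open>f - g\<close> of \<open>f\<close>.\<close>
  have "Phi_minus n f - Phi n g = Var n * ((subst ?p f - subst ?q f) + subst ?q (f - g))"
    by (simp add: Phi_minus_def Phi_def subst_diff algebra_simps)
  also have "\<dots> \<in> deg_less n (Suc d)"
  proof (rule deg_less_mult[OF Var_deg_less supp_in_add])
    show "subst ?p f - subst ?q f \<in> deg_less n d"
      by (rule subst_diff_deg_less[OF p q pq fd])
    show "subst ?q (f - g) \<in> deg_less n d"
      using f by (intro subst_deg_less[OF q]) (simp_all only: is_lift_def)
  qed (use n in auto)
  finally show "Phi_minus n f - Phi n g \<in> deg_less n (Suc d)" .
  show "vanishes n (Suc d) (Phi_minus n f)"
    using f by (intro vanishes_Phi_minus[OF n deg_less_polys[OF fd]]) (simp add: is_lift_def)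
qed

section \<open>The Demazure--Lusztig operators\<close>

lemma Var_diff_ne_0: "Var i - Var (Suc i) \<noteq> 0"
proof
  assume "Var i - Var (Suc i) = 0"
  then have "coef (Var i) (single i 1) = coef (Var (Suc i)) (single i 1)" by simp
  moreover have "single (Suc i) 1 \<noteq> (single i 1 :: expo)"
  proof
    assume "single (Suc i) 1 = (single i 1 :: expo)"
    then have "coef (single (Suc i) 1 :: expo) i = coef (single i 1) i" by simp
    then show False by (simp add: lookup_single)
  qed
  ultimately show False
    unfolding Var_def by (simp only: lookup_single when_def) simp
qed

lemma div_diff_eq:
  assumes "g * (Var i - Var (Suc i)) = s_op i f - f"
  shows "div_diff i f = g"
  unfolding div_diff_def
proof (rule the_equality)
  show "g * (Var i - Var (Suc i)) = s_op i f - f" by (rule assms)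
  fix h assume "h * (Var i - Var (Suc i)) = s_op i f - f"
  then have "h * (Var i - Var (Suc i)) = g * (Var i - Var (Suc i))"
    using assms by simp
  then show "h = g" using Var_diff_ne_0 by simp
qed

lemma s_op_Var: "s_op i (Var j) = Var (transpose i (Suc i) j)"
  by (simp add: s_op_def)

lemma transpose_mem: "i \<in> {1..n-1} \<Longrightarrow> j \<in> {1..n} \<Longrightarrow> transpose i (Suc i) j \<in> {1..n}"
  by (auto simp: transpose_def)

lemma s_op_deg_less:
  assumes "i \<in> {1..n-1}" "f \<in> deg_less n d"
  shows "s_op i f \<in> deg_less n d"
  unfolding s_op_def using transpose_mem[OF assms(1)]
  by (intro subst_deg_less[OF _ assms(2)] Var_deg_less)

lemma s_op_homogeneous:
  assumes "i \<in> {1..n-1}" "f \<in> homogeneous n d"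
  shows "s_op i f \<in> homogeneous n d"
  unfolding s_op_def using transpose_mem[OF assms(1)]
  by (intro subst_homogeneous[OF _ assms(2)] Var_homogeneous)

lemma s_op_polys:
  assumes "i \<in> {1..n-1}" "f \<in> polys n"
  shows "s_op i f \<in> polys n"
  unfolding s_op_def using transpose_mem[OF assms(1)]
  by (intro subst_polys[OF _ assms(2)] Var_deg_less)

text \<open>The twisted Leibniz rule \<open>s(uv) - uv = s(u)(s(v) - v) + (s(u) - u)v\<close>
  reduces divisibility to a single variable and shows that the quotient loses one degree.\<close>

lemma div_diff_monomial_exists:
  assumes i: "i \<in> {1..n-1}" and m: "m \<in> compositions n"
  shows "\<exists>g\<in>deg_less n (weight m). g * (Var i - Var (Suc i)) = s_op i (X m) - X m"
  using m
proof (induction rule: composition_induct)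
  case zero
  then show ?case by (intro bexI[of _ 0]) (simp_all add: s_op_def)
next
  case (step m j)
  then obtain g where g: "g \<in> deg_less n (weight m)"
    "g * (Var i - Var (Suc i)) = s_op i (X m) - X m" by blast
  \<comment> \<open>The divided difference of the variable \<open>x_j\<close>; it is -1 at
    \<open>x_i\<close> because the numerator is \<open>s_i f - f\<close>.\<close>
  define c :: ratfun where "c = (if j = i then -1 else if j = Suc i then 1 else 0)"
  have c: "s_op i (Var j) - Var j = Const c * (Var i - Var (Suc i))"
    by (auto simp: s_op_Var c_def Const_uminus)
  let ?g = "Const c * s_op i (X m) + g * Var j"
  have X: "X (m + single j 1) = X m * Var j"
    by (simp only: X_add X_single)
  have "s_op i (X m * Var j) - X m * Var j =
      s_op i (X m) * (s_op i (Var j) - Var j) + (s_op i (X m) - X m) * Var j"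
    by (simp add: s_op_def subst_mult algebra_simps)
  also have "\<dots> = ?g * (Var i - Var (Suc i))"
    unfolding c g(2)[symmetric] by (simp add: algebra_simps)
  finally have "?g * (Var i - Var (Suc i)) = s_op i (X (m + single j 1)) - X (m + single j 1)"
    unfolding X by (rule sym)
  moreover have "?g \<in> deg_less n (weight (m + single j 1))"
    unfolding weight_add weight_single
  proof (rule supp_in_add)
    show "Const c * s_op i (X m) \<in> deg_less n (weight m + 1)"
      using s_op_deg_less[OF i homogeneous_deg_less[OF X_homogeneous[OF step(1)]]]
      by (intro supp_in_Const) simp
    show "g * Var j \<in> deg_less n (weight m + 1)"
      by (rule deg_less_mult[OF g(1) Var_deg_less[OF step(2)]]) simp
  qed
  ultimately show ?case by blast
qed

lemma div_diff_exists:
  assumes i: "i \<in> {1..n-1}" and f: "f \<in> deg_less n (Suc d)"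
  shows "div_diff i f \<in> deg_less n d" "div_diff i f * (Var i - Var (Suc i)) = s_op i f - f"
proof -
  have m: "m \<in> compositions n \<and> weight m \<le> d" if "m \<in> supp f" for m
    using f that by (auto simp: supp_in_def)
  have "\<forall>m\<in>supp f. \<exists>g. g \<in> deg_less n d \<and> g * (Var i - Var (Suc i)) = s_op i (X m) - X m"
  proof
    fix m assume "m \<in> supp f"
    then obtain g where "g \<in> deg_less n (weight m)" "g * (Var i - Var (Suc i)) = s_op i (X m) - X m"
      using div_diff_monomial_exists[OF i] m by blast
    then show "\<exists>g. g \<in> deg_less n d \<and> g * (Var i - Var (Suc i)) = s_op i (X m) - X m"
      using deg_less_mono[of g n "weight m" d] m[OF \<open>m \<in> supp f\<close>] by blast
  qed
  from bchoice[OF this] obtain g where g: "\<And>m. m \<in> supp f \<Longrightarrow> g m \<in> deg_less n d"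
    "\<And>m. m \<in> supp f \<Longrightarrow> g m * (Var i - Var (Suc i)) = s_op i (X m) - X m"
    by blast
  define G where "G = (\<Sum>m\<in>supp f. Const (coef f m) * g m)"
  have "G * (Var i - Var (Suc i)) = (\<Sum>m\<in>supp f. Const (coef f m) * (g m * (Var i - Var (Suc i))))"
    by (simp only: G_def sum_distrib_right mult.assoc)
  also have "\<dots> = (\<Sum>m\<in>supp f. Const (coef f m) * (s_op i (X m) - X m))"
    by (simp only: g(2) cong: sum.cong)
  also have "\<dots> = s_op i (\<Sum>m\<in>supp f. Const (coef f m) * X m) - (\<Sum>m\<in>supp f. Const (coef f m) * X m)"
    by (simp add: s_op_def subst_sum subst_Const_mult right_diff_distrib sum_subtractf)
  also have "\<dots> = s_op i f - f"
    by (simp only: mpoly_sum_X[symmetric])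
  finally have G: "G * (Var i - Var (Suc i)) = s_op i f - f" .
  then have "div_diff i f = G" by (rule div_diff_eq)
  moreover have "G \<in> deg_less n d"
    unfolding G_def by (intro supp_in_sum supp_in_Const g(1))
  ultimately show "div_diff i f \<in> deg_less n d" "div_diff i f * (Var i - Var (Suc i)) = s_op i f - f"
    using G by simp_all
qed

lemma div_diff_mult:
  assumes "i \<in> {1..n-1}" "f \<in> polys n"
  shows "div_diff i f * (Var i - Var (Suc i)) = s_op i f - f"
  by (rule div_diff_exists(2)[OF assms(1) polys_total_degree[OF assms(2)]])

lemma linear_op_sigma_plus:
  assumes i: "i \<in> {1..n-1}"
  shows "linear_op n (sigma_plus i)"
proof -
  have "div_diff i (f + g) = div_diff i f + div_diff i g" if "f \<in> polys n" "g \<in> polys n" for f g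
    by (rule div_diff_eq) (simp add: distrib_right div_diff_mult[OF i] that s_op_def subst_add)
  moreover have "div_diff i (Const a * f) = Const a * div_diff i f" if f: "f \<in> polys n" for a f
  proof (rule div_diff_eq)
    have "Const a * div_diff i f * (Var i - Var (Suc i)) = Const a * (s_op i f - f)"
      by (simp only: mult.assoc div_diff_mult[OF i f])
    then show "Const a * div_diff i f * (Var i - Var (Suc i)) = s_op i (Const a * f) - Const a * f"
      by (simp only: s_op_def subst_Const_mult right_diff_distrib)
  qed
  ultimately show ?thesis
    by (simp add: linear_op_def sigma_plus_def s_op_def subst_add subst_Const_mult distrib_left add_ac mult.left_commute)
qed

text \<open>The conjugate of \<open>sigma_plus\<close> by \<open>x -> -x\<close>: the denominator
  \<open>x_i - x_(i+1)\<close> changes sign, which amounts to replacing r by -r.\<close>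

definition sigma_minus :: "nat \<Rightarrow> mpoly \<Rightarrow> mpoly" where
  "sigma_minus i f = s_op i f - Const r_ind * div_diff i f"

lemma sigma_plus_neg:
  assumes i: "i \<in> {1..n-1}" and f: "f \<in> polys n"
  shows "sigma_plus i (neg f) = neg (sigma_minus i f)"
proof -
  have s: "s_op i (neg f) = neg (s_op i f)"
    by (simp add: s_op_def subst_subst subst_uminus)
  have "neg (div_diff i f) * neg (Var i - Var (Suc i)) = neg (s_op i f - f)"
    by (simp only: subst_mult[symmetric] div_diff_mult[OF i f])
  then have "(- neg (div_diff i f)) * (Var i - Var (Suc i)) = s_op i (neg f) - neg f"
    by (simp add: subst_diff s algebra_simps)
  then have "div_diff i (neg f) = - neg (div_diff i f)"
    by (rule div_diff_eq)
  then show ?thesis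
    by (simp add: sigma_plus_def sigma_minus_def s subst_diff subst_Const_mult)
qed

lemma vanishes_sigma_minus:
  assumes i: "i \<in> {1..n-1}" and f: "f \<in> polys n" and van: "vanishes n d f"
  shows "vanishes n d (sigma_minus i f)"
  unfolding vanishes_def
proof
  fix \<gamma> assume \<gamma>: "\<gamma> \<in> comp_less n d"
  let ?t = "transpose i (Suc i)" and ?b = "bar n \<gamma>"
  let ?g = "eval_at ?b (div_diff i f)" and ?s = "eval_at (\<lambda>k. ?b (?t k)) f"
  have s: "eval_at ?b (s_op i f) = ?s"
    by (simp add: s_op_def eval_at_subst)
  have "eval_at ?b (div_diff i f * (Var i - Var (Suc i))) = eval_at ?b (s_op i f - f)"
    by (simp only: div_diff_mult[OF i f])
  \<comment> \<open>As \<open>f\<close> itself vanishes at this point, only the swapped value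
    \<open>?s\<close> remains of the numerator.\<close>
  then have g: "?g * (?b i - ?b (Suc i)) = ?s"
    using van \<gamma> by (simp add: eval_at_mult eval_at_diff s vanishes_def)
  have e: "eval_at ?b (sigma_minus i f) = ?s - r_ind * ?g"
    by (simp add: sigma_minus_def eval_at_diff eval_at_Const_mult s)
  show "eval_at ?b (sigma_minus i f) = 0"
  proof (cases "coef \<gamma> i = coef \<gamma> (Suc i)")
    case True
    then show ?thesis
      using g e bar_adjacent_equal[OF i True] by (simp add: mult.commute)
  next
    case False
    define \<gamma>' where "\<gamma>' = expo_of n (\<lambda>k. coef \<gamma> (?t k))"
    have t: "?t permutes {1..n}" using i by (intro permutes_swap_id) auto
    have c: "coef \<gamma>' k = coef \<gamma> (?t k)" for k
    proof (cases "k \<in> {1..n}")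
      case False
      then have "?t k \<notin> {1..n}" using permutes_in_image[OF t] by blast
      then show ?thesis
        using \<gamma> False coef_composition_outside[of \<gamma> n "?t k"] by (simp only: \<gamma>'_def coef_expo_of) auto
    qed (simp add: \<gamma>'_def coef_expo_of)
    have "weight \<gamma>' = weight \<gamma>"
      using \<gamma> sum.permute[OF t, of "coef \<gamma>"] weight_compositions[of \<gamma> n]
      by (simp add: \<gamma>'_def weight_expo_of comp_def)
    then have "\<gamma>' \<in> comp_less n d"
      using \<gamma> by (simp add: \<gamma>'_def expo_of_compositions)
    then have "eval_at (bar n \<gamma>') f = 0"
      using van by (simp add: vanishes_def)
    moreover have "eval_at (bar n \<gamma>') f = ?s"
      by (rule eval_at_cong[OF f bar_transpose[OF i False c]])
    \<comment> \<open>The denominator is nonzero at this point, so \<open>?s = 0\<close> forces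
      \<open>?g = 0\<close>.\<close>
    moreover have "?b i \<noteq> ?b (Suc i)" using bar_eq_imp False by blast
    ultimately show ?thesis using g e by simp
  qed
qed

text \<open>The divided difference lowers the degree, so the leading part comes from
  \<open>s_i\<close> alone.\<close>

lemma is_lift_sigma:
  assumes i: "i \<in> {1..n-1}" and g: "g \<in> homogeneous n d" and f: "is_lift n d g f"
  shows "is_lift n d (s_op i g) (sigma_minus i f)"
  unfolding is_lift_def
proof
  have fd: "f \<in> deg_less n (Suc d)" by (rule is_lift_deg_less[OF g f])
  have "sigma_minus i f - s_op i g = s_op i (f - g) - Const r_ind * div_diff i f"
    by (simp add: sigma_minus_def s_op_def subst_diff)
  also have "\<dots> \<in> deg_less n d"
  proof (rule supp_in_diff)
    show "s_op i (f - g) \<in> deg_less n d"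
      using f by (intro s_op_deg_less[OF i]) (simp only: is_lift_def)
    show "Const r_ind * div_diff i f \<in> deg_less n d"
      by (rule supp_in_Const[OF div_diff_exists(1)[OF i fd]])
  qed
  finally show "sigma_minus i f - s_op i g \<in> deg_less n d" .
  show "vanishes n d (sigma_minus i f)"
    using f by (intro vanishes_sigma_minus[OF i deg_less_polys[OF fd]]) (simp add: is_lift_def)
qed

section \<open>The commutation relations, checked on monomials\<close>

lemma Phi_plus_lift_op:
  assumes n: "n \<ge> 1" and f: "f \<in> polys n"
  shows "Phi_plus n (lift_op n f) = lift_op n (Phi n f)"
proof (rule linear_op_eqI[OF _ _ _ f])
  have "linear_op n (Phi n)" "linear_op n (Phi_plus n)"
    unfolding Phi_def[abs_def] Phi_plus_def[abs_def] by (rule linear_op_mult_subst)+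
  then show "linear_op n (\<lambda>f. Phi_plus n (lift_op n f))" "linear_op n (\<lambda>f. lift_op n (Phi n f))"
    using linear_op_comp[of n "Phi_plus n" "lift_op n"] linear_op_comp[of n "lift_op n" "Phi n"]
    by (simp_all add: linear_op_lift_op lift_op_polys Phi_polys[OF n])
  fix m assume m: "m \<in> compositions n"
  have "Phi_plus n (lift_op n (X m)) = Const ((-1) ^ weight m) * Phi_plus n (neg (lift n m))"
    unfolding lift_op_homogeneous[OF X_homogeneous[OF m] is_lift_lift]
    by (simp add: Phi_plus_def subst_Const_mult mult.left_commute)
  \<comment> \<open>The sign from \<open>Phi_plus_neg\<close> turns \<open>(-1) ^ weight m\<close>
    into the sign that belongs to the degree of \<open>Phi n (X m)\<close>.\<close>
  also have "\<dots> = Const ((-1) ^ Suc (weight m)) * neg (Phi_minus n (lift n m))"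
    by (simp add: Phi_plus_neg Const_uminus)
  also have "\<dots> = lift_op n (Phi n (X m))"
    by (rule lift_op_homogeneous[OF Phi_homogeneous[OF n X_homogeneous[OF m]]
          is_lift_Phi[OF n X_homogeneous[OF m] is_lift_lift], symmetric])
  finally show "Phi_plus n (lift_op n (X m)) = lift_op n (Phi n (X m))" .
qed

lemma sigma_plus_lift_op:
  assumes i: "i \<in> {1..n-1}" and f: "f \<in> polys n"
  shows "sigma_plus i (lift_op n f) = lift_op n (s_op i f)"
proof (rule linear_op_eqI[OF _ _ _ f])
  note lin = linear_op_sigma_plus[OF i]
  have "linear_op n (s_op i)"
    unfolding s_op_def[abs_def] by (rule linear_op_subst)
  then show "linear_op n (\<lambda>f. sigma_plus i (lift_op n f))" "linear_op n (\<lambda>f. lift_op n (s_op i f))"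
    using linear_op_comp[of n "sigma_plus i" "lift_op n"] linear_op_comp[of n "lift_op n" "s_op i"]
    by (simp_all add: lin linear_op_lift_op lift_op_polys s_op_polys[OF i])
  fix m assume m: "m \<in> compositions n"
  have "sigma_plus i (lift_op n (X m)) = Const ((-1) ^ weight m) * sigma_plus i (neg (lift n m))"
    unfolding lift_op_homogeneous[OF X_homogeneous[OF m] is_lift_lift]
    using lin neg_polys[OF lift_polys[OF m]] by (simp add: linear_op_def)
  also have "\<dots> = Const ((-1) ^ weight m) * neg (sigma_minus i (lift n m))"
    by (simp add: sigma_plus_neg[OF i lift_polys[OF m]])
  also have "\<dots> = lift_op n (s_op i (X m))"
    by (rule lift_op_homogeneous[OF s_op_homogeneous[OF i X_homogeneous[OF m]]
          is_lift_sigma[OF i X_homogeneous[OF m] is_lift_lift], symmetric])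
  finally show "sigma_plus i (lift_op n (X m)) = lift_op n (s_op i (X m))" .
qed

theorem theorem3p7:
  fixes n :: nat
  assumes "n \<ge> 1"
  shows "(\<forall>f\<in>polys n. Phi_plus n (Xi n f) = Xi n (Phi n f)) \<and>
         (\<forall>i\<in>{1..n - 1}. \<forall>f\<in>polys n. sigma_plus i (Xi n f) = Xi n (s_op i f))"
  using assms
  by (simp add: Xi_eq Phi_polys s_op_polys Phi_plus_lift_op sigma_plus_lift_op)

end
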